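(* As $n\to\infty$, the proportion of Latin squares of order $n$ which have a non-trivial autoparatopy group is at most $n^{-3n^2/8+o(n^2)}$.
   Context: A Latin square of order $n$ is an $n\times n$ array with entries from $\{1,\dots,n\}$ in which each row and each column contains each symbol exactly once; equivalently, a set of $n^2$ triples (row, column, symbol). An isotopism applies a permutation to the rows, a permutation to the columns and a permutation to the symbols. Conjugation uniformly permutes the three coordinates of every triple (6 possibilities). A paratopism is the composition of an isotopism with a conjugation; an autoparatopism of $L$ is a paratopism mapping $L$ to itself, and these form the autoparatopy group of $L$. *)

theory Defs
  imports
    Complex_Main
    "HOL-Library.Landau_Symbols"
    "HOL-Combinatorics.Permutations"
    "HOL-Algebra.Bij"
    "HOL-Algebra.Elementary_Groups"
begin

definition triples :: "nat \<Rightarrow> (nat \<times> nat \<times> nat) set" where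
  "triples n = {1..n} \<times> {1..n} \<times> {1..n}"

text \<open>The first condition says that the triples form an array (one symbol in each cell); the second
  and the third say that each row, respectively column, contains each symbol exactly once.\<close>

definition latin_square :: "nat \<Rightarrow> (nat \<times> nat \<times> nat) set \<Rightarrow> bool" where
  "latin_square n L \<longleftrightarrow>
     L \<subseteq> triples n \<and>
     (\<forall>r\<in>{1..n}. \<forall>c\<in>{1..n}. \<exists>!s. (r, c, s) \<in> L) \<and>
     (\<forall>r\<in>{1..n}. \<forall>s\<in>{1..n}. \<exists>!c. (r, c, s) \<in> L) \<and>
     (\<forall>c\<in>{1..n}. \<forall>s\<in>{1..n}. \<exists>!r. (r, c, s) \<in> L)"

datatype axis = Row | Col | Sym

fun coord :: "'a \<times> 'a \<times> 'a \<Rightarrow> axis \<Rightarrow> 'a" where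
  "coord (r, c, s) Row = r"
| "coord (r, c, s) Col = c"
| "coord (r, c, s) Sym = s"

definition conjugation :: "(axis \<Rightarrow> axis) \<Rightarrow> 'a \<times> 'a \<times> 'a \<Rightarrow> 'a \<times> 'a \<times> 'a" where
  "conjugation \<pi> t = (coord t (\<pi> Row), coord t (\<pi> Col), coord t (\<pi> Sym))"

definition isotopism ::
  "(nat \<Rightarrow> nat) \<Rightarrow> (nat \<Rightarrow> nat) \<Rightarrow> (nat \<Rightarrow> nat) \<Rightarrow> nat \<times> nat \<times> nat \<Rightarrow> nat \<times> nat \<times> nat" where
  "isotopism \<alpha> \<beta> \<gamma> = (\<lambda>(r, c, s). (\<alpha> r, \<beta> c, \<gamma> s))"

text \<open>Paratopisms are taken as maps on the set of all \<open>n\<^sup>3\<close> triples, restricted to that set so that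
  they are elements of the library's group of bijections of it. For \<open>n \<ge> 2\<close> distinct data
  \<open>(\<alpha>, \<beta>, \<gamma>, \<pi>)\<close> give distinct maps.\<close>

definition paratopisms :: "nat \<Rightarrow> (nat \<times> nat \<times> nat \<Rightarrow> nat \<times> nat \<times> nat) set" where
  "paratopisms n =
     {restrict (isotopism \<alpha> \<beta> \<gamma> \<circ> conjugation \<pi>) (triples n) | \<alpha> \<beta> \<gamma> \<pi>.
        \<alpha> permutes {1..n} \<and> \<beta> permutes {1..n} \<and> \<gamma> permutes {1..n} \<and> bij \<pi>}"

definition autoparatopisms ::
  "nat \<Rightarrow> (nat \<times> nat \<times> nat) set \<Rightarrow> (nat \<times> nat \<times> nat \<Rightarrow> nat \<times> nat \<times> nat) set" where
  "autoparatopisms n L = {\<phi> \<in> paratopisms n. \<phi> ` L = L}"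

definition autoparatopy_group ::
  "nat \<Rightarrow> (nat \<times> nat \<times> nat) set \<Rightarrow> (nat \<times> nat \<times> nat \<Rightarrow> nat \<times> nat \<times> nat) monoid" where
  "autoparatopy_group n L = BijGroup (triples n) \<lparr>carrier := autoparatopisms n L\<rparr>"

lemma conjugation_isotopism:
  "conjugation \<pi> (isotopism \<alpha> \<beta> \<gamma> t) =
   isotopism (coord (\<alpha>, \<beta>, \<gamma>) (\<pi> Row)) (coord (\<alpha>, \<beta>, \<gamma>) (\<pi> Col)) (coord (\<alpha>, \<beta>, \<gamma>) (\<pi> Sym))
     (conjugation \<pi> t)"
proof -
  have "coord (isotopism \<alpha> \<beta> \<gamma> t) a = coord (\<alpha>, \<beta>, \<gamma>) a (coord t a)" for a
    by (cases t; cases a) (auto simp: isotopism_def)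
  then show ?thesis by (simp add: conjugation_def isotopism_def)
qed

lemma conjugation_conjugation: "conjugation \<pi> (conjugation \<rho> t) = conjugation (\<rho> \<circ> \<pi>) t"
proof -
  have "coord (conjugation \<rho> t) a = coord t (\<rho> a)" for a
    by (cases a) (auto simp: conjugation_def)
  then show ?thesis by (simp add: conjugation_def)
qed

lemma conjugation_id: "conjugation id t = t"
  by (cases t) (simp add: conjugation_def)

lemma isotopism_isotopism:
  "isotopism \<alpha> \<beta> \<gamma> (isotopism \<alpha>' \<beta>' \<gamma>' t) = isotopism (\<alpha> \<circ> \<alpha>') (\<beta> \<circ> \<beta>') (\<gamma> \<circ> \<gamma>') t"
  by (cases t) (simp add: isotopism_def)

lemma isotopism_id: "isotopism id id id t = t"
  by (cases t) (simp add: isotopism_def)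

lemma coord_permutes:
  assumes "\<alpha> permutes A" "\<beta> permutes A" "\<gamma> permutes A"
  shows "coord (\<alpha>, \<beta>, \<gamma>) a permutes A"
  using assms by (cases a) auto

lemma isotopism_triples:
  assumes "\<alpha> permutes {1..n}" "\<beta> permutes {1..n}" "\<gamma> permutes {1..n}" "t \<in> triples n"
  shows "isotopism \<alpha> \<beta> \<gamma> t \<in> triples n"
  using assms(4) permutes_in_image[OF assms(1)] permutes_in_image[OF assms(2)]
    permutes_in_image[OF assms(3)]
  by (auto simp: isotopism_def triples_def simp del: atLeastAtMost_iff)

lemma conjugation_triples:
  assumes "t \<in> triples n"
  shows "conjugation \<pi> t \<in> triples n"
proof -
  have "coord t a \<in> {1..n}" for a
    using assms by (cases t; cases a) (auto simp: triples_def)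
  then show ?thesis by (simp add: conjugation_def triples_def)
qed

lemma paratopism_funcset: "\<phi> \<in> paratopisms n \<Longrightarrow> \<phi> \<in> triples n \<rightarrow> triples n"
  by (auto simp: paratopisms_def intro!: isotopism_triples conjugation_triples)

lemma id_paratopism: "(\<lambda>t\<in>triples n. t) \<in> paratopisms n"
  unfolding paratopisms_def
  by (intro CollectI exI[of _ id] conjI)
     (auto simp: permutes_id isotopism_id conjugation_id restrict_def fun_eq_iff)

lemma compose_paratopism:
  assumes "\<phi> \<in> paratopisms n" "\<psi> \<in> paratopisms n"
  shows "compose (triples n) \<phi> \<psi> \<in> paratopisms n"
proof -
  obtain a b c p where 1: "\<phi> = restrict (isotopism a b c \<circ> conjugation p) (triples n)"
    "a permutes {1..n}" "b permutes {1..n}" "c permutes {1..n}" "bij p"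
    using assms(1) unfolding paratopisms_def by blast
  obtain d e f q where 2: "\<psi> = restrict (isotopism d e f \<circ> conjugation q) (triples n)"
    "d permutes {1..n}" "e permutes {1..n}" "f permutes {1..n}" "bij q"
    using assms(2) unfolding paratopisms_def by blast
  let ?D = "\<lambda>x. coord (d, e, f) (p x)"
  have "compose (triples n) \<phi> \<psi> =
    restrict (isotopism (a \<circ> ?D Row) (b \<circ> ?D Col) (c \<circ> ?D Sym) \<circ> conjugation (q \<circ> p)) (triples n)"
    using paratopism_funcset[OF assms(2)]
    by (auto simp: fun_eq_iff compose_def 1(1) 2(1) conjugation_isotopism isotopism_isotopism
        conjugation_conjugation isotopism_triples[OF 2(2-4)] conjugation_triples)
  moreover have "?D x permutes {1..n}" for x by (rule coord_permutes[OF 2(2-4)])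
  ultimately show ?thesis
    unfolding paratopisms_def using 1 2 by (blast intro: permutes_compose bij_comp)
qed

lemma paratopism_left_inverse:
  assumes "\<phi> \<in> paratopisms n"
  obtains \<psi> where "\<psi> \<in> paratopisms n" "\<And>t. t \<in> triples n \<Longrightarrow> \<psi> (\<phi> t) = t"
proof -
  obtain a b c p where 1: "\<phi> = restrict (isotopism a b c \<circ> conjugation p) (triples n)"
    "a permutes {1..n}" "b permutes {1..n}" "c permutes {1..n}" "bij p"
    using assms(1) unfolding paratopisms_def by blast
  let ?q = "inv_into UNIV p"
  let ?D = "\<lambda>x. coord (inv_into UNIV a, inv_into UNIV b, inv_into UNIV c) (?q x)"
  define \<psi> where "\<psi> = restrict (isotopism (?D Row) (?D Col) (?D Sym) \<circ> conjugation ?q) (triples n)"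
  have "?D x permutes {1..n}" for x by (intro coord_permutes permutes_inv 1)
  moreover have "bij ?q" using 1(5) by (rule bij_imp_bij_inv)
  ultimately have "\<psi> \<in> paratopisms n" unfolding \<psi>_def paratopisms_def by blast
  moreover have "\<psi> (\<phi> t) = t" if t: "t \<in> triples n" for t
  proof -
    have "\<psi> (\<phi> t) =
      conjugation ?q (isotopism (inv_into UNIV a) (inv_into UNIV b) (inv_into UNIV c) (isotopism a b c (conjugation p t)))"
      using t by (simp add: \<psi>_def 1(1) isotopism_triples[OF 1(2-4)] conjugation_triples
          conjugation_isotopism)
    also have "\<dots> = t"
      using permutes_inv_o(2)[OF 1(2)] permutes_inv_o(2)[OF 1(3)] permutes_inv_o(2)[OF 1(4)]
        bij_is_surj[OF 1(5)]
      by (simp add: isotopism_isotopism isotopism_id conjugation_conjugation surj_iff[THEN iffD1]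
          conjugation_id)
    finally show ?thesis .
  qed
  ultimately show ?thesis using that by blast
qed

lemma paratopism_Bij: "\<phi> \<in> paratopisms n \<Longrightarrow> \<phi> \<in> Bij (triples n)"
proof -
  assume \<phi>: "\<phi> \<in> paratopisms n"
  obtain \<psi> where \<psi>: "\<psi> \<in> paratopisms n" "\<And>t. t \<in> triples n \<Longrightarrow> \<psi> (\<phi> t) = t"
    using paratopism_left_inverse[OF \<phi>] by blast
  have inj: "inj_on \<phi> (triples n)" by (metis \<psi>(2) inj_onI)
  have "finite (triples n)" by (simp add: triples_def)
  moreover have "\<phi> ` triples n \<subseteq> triples n" using paratopism_funcset[OF \<phi>] by blast
  ultimately have "\<phi> ` triples n = triples n" using inj by (metis endo_inj_surj)
  moreover have "\<phi> \<in> extensional (triples n)" using \<phi> by (auto simp: paratopisms_def)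
  ultimately show ?thesis using inj by (simp add: Bij_def bij_betw_def)
qed

lemma subgroup_autoparatopisms:
  assumes "L \<subseteq> triples n"
  shows "subgroup (autoparatopisms n L) (BijGroup (triples n))"
proof (rule subgroup.intro)
  show "autoparatopisms n L \<subseteq> carrier (BijGroup (triples n))"
    by (auto simp: autoparatopisms_def BijGroup_def paratopism_Bij)
next
  fix x y assume x: "x \<in> autoparatopisms n L" and y: "y \<in> autoparatopisms n L"
  have "compose (triples n) x y ` L = x ` y ` L"
    using assms by (force simp: compose_def image_image intro!: image_cong)
  then show "x \<otimes>\<^bsub>BijGroup (triples n)\<^esub> y \<in> autoparatopisms n L"
    using x y by (simp add: autoparatopisms_def BijGroup_def paratopism_Bij compose_paratopism)
next
  have "(\<lambda>t\<in>triples n. t) ` L = L" using assms by (auto simp: image_iff subset_iff)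
  then show "\<one>\<^bsub>BijGroup (triples n)\<^esub> \<in> autoparatopisms n L"
    by (simp add: autoparatopisms_def BijGroup_def id_paratopism)
next
  fix x assume x: "x \<in> autoparatopisms n L"
  then have xp: "x \<in> paratopisms n" and xL: "x ` L = L" by (auto simp: autoparatopisms_def)
  obtain y where y: "y \<in> paratopisms n" "\<And>t. t \<in> triples n \<Longrightarrow> y (x t) = t"
    using paratopism_left_inverse[OF xp] by blast
  have "compose (triples n) y x = (\<lambda>t\<in>triples n. t)" using y by (auto simp: compose_def)
  then have "y \<otimes>\<^bsub>BijGroup (triples n)\<^esub> x = \<one>\<^bsub>BijGroup (triples n)\<^esub>"
    using y xp by (simp add: BijGroup_def paratopism_Bij)
  then have "inv\<^bsub>BijGroup (triples n)\<^esub> x = y"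
    using y xp by (intro group.inv_equality group_BijGroup) (auto simp: BijGroup_def paratopism_Bij)
  moreover have "y ` L = L"
  proof -
    have "y ` x ` L = L" using y(2) assms by (force simp: image_image)
    then show ?thesis by (simp add: xL)
  qed
  ultimately show "inv\<^bsub>BijGroup (triples n)\<^esub> x \<in> autoparatopisms n L"
    using y by (simp add: autoparatopisms_def)
qed

lemma group_autoparatopy_group:
  assumes "latin_square n L"
  shows "group (autoparatopy_group n L)"
  unfolding autoparatopy_group_def
  by (intro subgroup.subgroup_is_group subgroup_autoparatopisms group_BijGroup)
     (use assms in \<open>simp add: latin_square_def\<close>)

end

theory Submission
  imports Defs "HOL-Combinatorics.Multiset_Permutations" "HOL-Real_Asymp.Real_Asymp"
begin

text \<open>Upper bound. Let \<open>\<phi>\<close> be a non-identity autoparatopism of \<open>L\<close>. At most \<open>n\<^sup>2/4\<close> triples of \<open>L\<close> are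
  fixed by \<open>\<phi>\<close>, so \<open>L\<close> consists of at most \<open>5n\<^sup>2/8\<close> orbits and is determined by \<open>\<phi>\<close> and a set of at
  most \<open>5n\<^sup>2/8\<close> of the \<open>n\<^sup>3\<close> triples. There are at most \<open>n\<^bsup>5n\<^sup>2/8\<^esup> e\<^bsup>n\<^sup>2\<^esup>\<close> such sets and \<open>n\<^bsup>O(n)\<^esup>\<close>
  paratopisms.

  Lower bound. A Latin square is a proper \<open>n\<close>-edge-colouring of \<open>K\<^bsub>n,n\<^esub>\<close>. By Schrijver's argument on
  Eulerian orientations, a \<open>2k\<close>-regular bipartite graph with parts of size \<open>n\<close> has at least
  \<open>(2\<^bsup>-k\<^esup> (2k choose k))\<^bsup>2n\<^esup>\<close> subgraphs that are \<open>k\<close>-regular. Halving repeatedly, and removing a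
  perfect matching whenever the degree is odd, yields at least \<open>n\<^bsup>n\<^sup>2\<^esup> e\<^bsup>-8n\<^sup>2\<^esup>\<close> Latin squares.\<close>

section \<open>Latin squares with a given symmetry\<close>

text \<open>Each orbit contributes at least 2 to the right-hand side: a fixed point counts in both
  summands, and any other orbit has at least two elements. The induction splits off one orbit at a
  time; forward iterates reach the whole orbit because \<open>X\<close> is finite.\<close>

lemma orbit_representatives:
  assumes "finite X" "f ` X = X"
  shows "\<exists>R\<subseteq>X. 2 * card R \<le> card X + card {x\<in>X. f x = x} \<and> X = (\<Union>x\<in>R. range (\<lambda>k. (f ^^ k) x))"
  using assms
proof (induction X rule: finite_psubset_induct)
  case (psubset X)
  show ?case
  proof (cases "X = {}")
    case True
    then show ?thesis by simp
  next
    case False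
    then obtain x where x: "x \<in> X" by blast
    define Orb where "Orb = range (\<lambda>k. (f ^^ k) x)"
    have "(f ^^ k) x \<in> X" for k using x psubset.prems by (induction k) auto
    then have sub: "Orb \<subseteq> X" by (auto simp: Orb_def)
    have inj: "inj_on f X" using psubset by (simp add: eq_card_imp_inj_on)
    have fin: "finite Orb" using sub psubset.hyps finite_subset by blast
    have "f ((f ^^ k) x) \<in> Orb" for k unfolding Orb_def by (rule range_eqI[of _ _ "Suc k"]) simp
    then have "f ` Orb \<subseteq> Orb" by (auto simp: Orb_def)
    then have imO: "f ` Orb = Orb" using fin inj sub by (meson endo_inj_surj inj_on_subset)
    have imX: "f ` (X - Orb) = X - Orb"
      using inj_on_image_set_diff[OF inj, of X Orb] sub psubset.prems imO by auto
    have xO: "x \<in> Orb" unfolding Orb_def by (rule range_eqI[of _ _ 0]) simp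
    then have "X - Orb \<subset> X" using x by blast
    from psubset.IH[OF this imX] obtain R where R: "R \<subseteq> X - Orb"
      "2 * card R \<le> card (X - Orb) + card {y \<in> X - Orb. f y = y}"
      "X - Orb = (\<Union>x\<in>R. range (\<lambda>k. (f ^^ k) x))" by blast
    have finR: "finite R" using R(1) psubset.hyps finite_subset by blast
    have "card (insert x R) = Suc (card R)" using R(1) xO finR by (subst card_insert_disjoint) auto
    moreover have "card X = card (X - Orb) + card Orb"
      using card_Diff_subset[OF fin sub] card_mono[OF psubset.hyps sub] by simp
    \<comment> \<open>The removed orbit accounts for 2: either a single element that is also a lost
      fixed point, or at least the two elements \<open>x\<close> and \<open>f x\<close>.\<close>
    moreover have "2 + card {y \<in> X - Orb. f y = y} \<le> card Orb + card {y \<in> X. f y = y}"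
    proof (cases "f x = x")
      case True
      have "{y \<in> X - Orb. f y = y} \<subset> {y \<in> X. f y = y}" using True x xO by blast
      then have "card {y \<in> X - Orb. f y = y} < card {y \<in> X. f y = y}"
        using psubset.hyps by (intro psubset_card_mono) auto
      moreover have "card Orb \<ge> 1" using xO fin by (metis One_nat_def Suc_leI card_gt_0_iff empty_iff)
      ultimately show ?thesis by linarith
    next
      case False
      have "{x, f x} \<subseteq> Orb" using xO imO by blast
      then have "card {x, f x} \<le> card Orb" using fin card_mono by blast
      moreover have "card {y \<in> X - Orb. f y = y} \<le> card {y \<in> X. f y = y}"
        using psubset.hyps by (intro card_mono) auto
      ultimately show ?thesis using False by auto
    qed
    moreover have "X = (\<Union>x\<in>insert x R. range (\<lambda>k. (f ^^ k) x))"
      using R(3) sub Orb_def by auto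
    ultimately show ?thesis using R x by (intro exI[of _ "insert x R"]) auto
  qed
qed

section \<open>Latin squares in terms of coordinates\<close>

lemma finite_triples [simp]: "finite (triples n)"
  by (simp add: triples_def)

lemma card_triples: "card (triples n) = n ^ 3"
  by (simp add: triples_def card_cartesian_product power3_eq_cube)

lemma coord_eqI: "(\<And>a. coord t a = coord u a) \<Longrightarrow> t = u"
  by (cases t; cases u) (metis coord.simps)

lemma coord_in: "t \<in> triples n \<Longrightarrow> coord t a \<in> {1..n}"
  by (cases t; cases a) (auto simp: triples_def)

lemma latin_square_subset: "latin_square n L \<Longrightarrow> L \<subseteq> triples n"
  by (simp add: latin_square_def)

text \<open>With axes as indices, the three uniqueness conditions become one symmetric statement, so
  later arguments can pick axes without a case split over conjugates.\<close>

lemma latin_square_inj_on_coords: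
  assumes "latin_square n L" "a \<noteq> b"
  shows "inj_on (\<lambda>t. (coord t a, coord t b)) L"
proof (rule inj_onI)
  fix t u assume tu: "t \<in> L" "u \<in> L" "(coord t a, coord t b) = (coord u a, coord u b)"
  obtain r c s r' c' s' where eq: "t = (r, c, s)" "u = (r', c', s')" by (metis prod_cases3)
  have "r \<in> {1..n}" "c \<in> {1..n}" "s \<in> {1..n}"
    using latin_square_subset[OF assms(1)] tu eq by (auto simp: triples_def)
  then have "\<exists>!s. (r, c, s) \<in> L" "\<exists>!c. (r, c, s) \<in> L" "\<exists>!r. (r, c, s) \<in> L"
    using assms(1) unfolding latin_square_def by simp_all
  then have "(r, c, s') \<in> L \<Longrightarrow> s' = s" "(r, c', s) \<in> L \<Longrightarrow> c' = c" "(r', c, s) \<in> L \<Longrightarrow> r' = r"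
    using tu(1) unfolding eq by blast+
  moreover have "r = r' \<and> c = c' \<or> r = r' \<and> s = s' \<or> c = c' \<and> s = s'"
    using tu(3) assms(2) unfolding eq by (cases a; cases b) simp_all
  ultimately show "t = u" using tu(2) unfolding eq by metis
qed

lemma latin_square_coords_ex:
  assumes "latin_square n L" "a \<noteq> b" "i \<in> {1..n}" "j \<in> {1..n}"
  shows "\<exists>t\<in>L. coord t a = i \<and> coord t b = j"
proof -
  have "\<exists>s. (i, j, s) \<in> L" "\<exists>s. (j, i, s) \<in> L" "\<exists>c. (i, c, j) \<in> L" "\<exists>c. (j, c, i) \<in> L"
    "\<exists>r. (r, i, j) \<in> L" "\<exists>r. (r, j, i) \<in> L"
    using assms unfolding latin_square_def by (simp_all add: ex1_implies_ex)
  then show ?thesis using assms(2)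
    by (cases a; cases b) (simp_all, (metis coord.simps)+)
qed

lemma card_latin_square:
  assumes "latin_square n L"
  shows "card L = n\<^sup>2"
proof -
  let ?h = "\<lambda>t. (coord t Row, coord t Col)"
  have "?h ` L = {1..n} \<times> {1..n}"
  proof
    show "?h ` L \<subseteq> {1..n} \<times> {1..n}"
      using latin_square_subset[OF assms] coord_in by blast
    show "{1..n} \<times> {1..n} \<subseteq> ?h ` L"
    proof clarify
      fix r c assume "r \<in> {1..n}" "c \<in> {1..n}"
      from latin_square_coords_ex[OF assms _ this, of Row Col]
      show "(r, c) \<in> ?h ` L" by (auto simp: image_iff)
    qed
  qed
  then have "card ({1..n} \<times> {1..n}) = card L"
    using card_image[OF latin_square_inj_on_coords[OF assms, of Row Col]] by simp
  then show ?thesis by (simp add: card_cartesian_product power2_eq_square)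
qed

section \<open>Fixed triples of an autoparatopism\<close>

lemma coord_paratopism:
  assumes "t \<in> triples n"
  shows "coord (restrict (isotopism \<alpha> \<beta> \<gamma> \<circ> conjugation \<pi>) (triples n) t) a =
    coord (\<alpha>, \<beta>, \<gamma>) a (coord t (\<pi> a))"
  using assms by (cases a) (auto simp: isotopism_def conjugation_def)

text \<open>Two coordinates determine a triple of \<open>L\<close>, and here coordinate
  \<open>a\<close> is a function of coordinate \<open>b\<close>; so \<open>b\<close> alone
  determines it. This covers paratopisms that move an axis.\<close>

lemma card_fixed_conjugating:
  assumes L: "latin_square n L" and "b \<noteq> a"
    and fixed: "\<And>t. t \<in> F \<Longrightarrow> t \<in> L \<and> coord t a = \<delta> (coord t b)"
  shows "card F \<le> n"
proof -
  have "inj_on (\<lambda>t. coord t b) F"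
  proof (rule inj_onI)
    fix t u assume "t \<in> F" "u \<in> F" "coord t b = coord u b"
    then show "t = u"
      using fixed[of t] fixed[of u] inj_onD[OF latin_square_inj_on_coords[OF L assms(2)], of t u] by auto
  qed
  moreover have "(\<lambda>t. coord t b) ` F \<subseteq> {1..n}"
    using fixed latin_square_subset[OF L] coord_in by blast
  ultimately have "card F \<le> card {1..n}" by (intro card_inj_on_le) auto
  then show ?thesis by simp
qed

text \<open>If line \<open>i\<close> of axis \<open>a\<close> is moved, then along that line the fixed values of the second axis meet
  only moved values of the third, so the numbers of fixed values of these two axes add up to at
  most \<open>n\<close>.\<close>

lemma card_fixed_isotopism:
  assumes L: "latin_square n L" and \<phi>: "\<phi> ` L = L"
    and act: "\<And>t x. t \<in> L \<Longrightarrow> coord (\<phi> t) x = \<delta> x (coord t x)"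
    and i: "i \<in> {1..n}" "\<delta> a i \<noteq> i"
  shows "4 * card {t\<in>L. \<phi> t = t} \<le> n\<^sup>2"
proof -
  obtain b c where abc: "a \<noteq> b" "a \<noteq> c" "b \<noteq> c" by (cases a) auto
  define P where "P = {j\<in>{1..n}. \<delta> b j = j}"
  define Q where "Q = {j\<in>{1..n}. \<delta> c j = j}"
  have [simp]: "finite P" "finite Q" by (auto simp: P_def Q_def)
  let ?F = "{t\<in>L. \<phi> t = t}"
  have "(\<lambda>t. (coord t b, coord t c)) ` ?F \<subseteq> P \<times> Q"
  proof clarify
    fix t assume t: "t \<in> L" "\<phi> t = t"
    then have "coord t b \<in> {1..n}" "coord t c \<in> {1..n}"
      using latin_square_subset[OF L] coord_in by blast+
    then show "coord t b \<in> P \<and> coord t c \<in> Q" using act[OF t(1), of b] act[OF t(1), of c] t(2) by (simp add: P_def Q_def)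
  qed
  moreover have "inj_on (\<lambda>t. (coord t b, coord t c)) ?F"
    using latin_square_inj_on_coords[OF L abc(3)] by (rule inj_on_subset) auto
  ultimately have F: "card ?F \<le> card P * card Q"
    using card_inj_on_le[of "\<lambda>t. (coord t b, coord t c)" ?F "P \<times> Q"]
    by (simp add: card_cartesian_product)
  obtain T where T: "\<And>j. j \<in> {1..n} \<Longrightarrow> T j \<in> L \<and> coord (T j) a = i \<and> coord (T j) b = j"
    using latin_square_coords_ex[OF L abc(1) i(1)] by metis
  have "(\<lambda>j. coord (T j) c) ` P \<subseteq> {1..n} - Q"
  proof clarify
    fix j assume j: "j \<in> P"
    then have Tj: "T j \<in> L" "coord (T j) a = i" "coord (T j) b = j" using T by (auto simp: P_def)
    \<comment> \<open>Otherwise \<open>\<phi> (T j)\<close> and \<open>T j\<close> agree on axes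
      \<open>b\<close> and \<open>c\<close> and hence coincide, although \<open>\<phi>\<close> moves
      the value \<open>i\<close> on axis \<open>a\<close>.\<close>
    have "coord (T j) c \<notin> Q"
    proof
      assume "coord (T j) c \<in> Q"
      then have "coord (\<phi> (T j)) c = coord (T j) c" using act[OF Tj(1)] by (simp add: Q_def)
      moreover have "coord (\<phi> (T j)) b = coord (T j) b" using act[OF Tj(1)] j Tj by (simp add: P_def)
      moreover have "\<phi> (T j) \<in> L" using \<phi> Tj by blast
      ultimately have "\<phi> (T j) = T j"
        using inj_onD[OF latin_square_inj_on_coords[OF L abc(3)]] Tj by auto
      then show False using act[OF Tj(1), of a] Tj i by simp
    qed
    moreover have "coord (T j) c \<in> {1..n}" using Tj(1) latin_square_subset[OF L] coord_in by blast
    ultimately show "coord (T j) c \<in> {1..n} - Q" by blast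
  qed
  moreover have "inj_on (\<lambda>j. coord (T j) c) P"
  proof (rule inj_onI)
    fix j k assume jk: "j \<in> P" "k \<in> P" "coord (T j) c = coord (T k) c"
    then have jk': "j \<in> {1..n}" "k \<in> {1..n}" by (simp_all add: P_def)
    then have "T j = T k"
      using inj_onD[OF latin_square_inj_on_coords[OF L abc(2)], of "T j" "T k"] jk(3) T by simp
    then show "j = k" using T jk' by metis
  qed
  ultimately have "card P \<le> card ({1..n} - Q)" by (intro card_inj_on_le) auto
  moreover have "card ({1..n} - Q) + card Q = n"
  proof -
    have "Q \<subseteq> {1..n}" by (auto simp: Q_def)
    then show ?thesis using card_Diff_subset[of Q "{1..n}"] card_mono[of "{1..n}" Q] by simp
  qed
  ultimately have PQ: "card P + card Q \<le> n" by linarith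
  have "4 * (card P * card Q) \<le> (card P + card Q)\<^sup>2"
  proof -
    have "0 \<le> (int (card P) - int (card Q))\<^sup>2" by simp
    then have "int (4 * (card P * card Q)) \<le> int ((card P + card Q)\<^sup>2)"
      by (simp add: power2_eq_square algebra_simps)
    then show ?thesis by linarith
  qed
  also have "\<dots> \<le> n\<^sup>2" using PQ by (simp add: power_mono)
  finally show ?thesis using F by linarith
qed

text \<open>If the conjugation moves an axis, at most \<open>n\<close> triples are fixed, and
  \<open>n\<close> is at most \<open>n^2 / 4\<close> once \<open>4 \<le> n\<close>. Otherwise
  \<open>\<phi>\<close> acts as an isotopism, and being different from the identity it moves some
  value on some axis.\<close>

lemma card_fixed_autoparatopism:
  assumes L: "latin_square n L" and \<phi>: "\<phi> \<in> autoparatopisms n L" "\<phi> \<noteq> (\<lambda>t\<in>triples n. t)" and "4 \<le> n"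
  shows "4 * card {t\<in>L. \<phi> t = t} \<le> n\<^sup>2"
proof -
  obtain \<alpha> \<beta> \<gamma> \<pi> where \<phi>_eq: "\<phi> = restrict (isotopism \<alpha> \<beta> \<gamma> \<circ> conjugation \<pi>) (triples n)"
    and \<phi>L: "\<phi> ` L = L"
    using \<phi>(1) unfolding autoparatopisms_def paratopisms_def by blast
  define \<delta> where "\<delta> = coord (\<alpha>, \<beta>, \<gamma>)"
  have act: "coord (\<phi> t) a = \<delta> a (coord t (\<pi> a))" if "t \<in> triples n" for t a
    unfolding \<phi>_eq \<delta>_def by (rule coord_paratopism[OF that])
  show ?thesis
  proof (cases "\<forall>a. \<pi> a = a")
    case False
    then obtain a where a: "\<pi> a \<noteq> a" by blast
    have "coord t a = \<delta> a (coord t (\<pi> a))" if "t \<in> L" "\<phi> t = t" for t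
      using act[of t a] that latin_square_subset[OF L] by auto
    then have "card {t\<in>L. \<phi> t = t} \<le> n"
      using card_fixed_conjugating[OF L a, where F = "{t\<in>L. \<phi> t = t}" and \<delta> = "\<delta> a"] by simp
    moreover have "4 * n \<le> n\<^sup>2" using assms(4) by (simp add: power2_eq_square)
    ultimately show ?thesis by linarith
  next
    case True
    have "\<exists>a. \<exists>i\<in>{1..n}. \<delta> a i \<noteq> i"
    proof (rule ccontr)
      assume *: "\<not> ?thesis"
      have "\<phi> t = t" if "t \<in> triples n" for t
        by (rule coord_eqI) (use * True act[OF that] coord_in[OF that] in auto)
      \<comment> \<open>Both maps are \<open>undefined\<close> outside \<open>triples n\<close>, so
        agreement on the triples would make them equal as functions.\<close>
      moreover have "\<phi> t = undefined" if "t \<notin> triples n" for t using that by (simp add: \<phi>_eq)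
      ultimately have "\<phi> t = (\<lambda>t\<in>triples n. t) t" for t by (cases "t \<in> triples n") auto
      then show False using \<phi>(2) by blast
    qed
    then obtain a i where "i \<in> {1..n}" "\<delta> a i \<noteq> i" by blast
    moreover have "coord (\<phi> t) x = \<delta> x (coord t x)" if "t \<in> L" for t x
      using act[of t x] True that latin_square_subset[OF L] by auto
    ultimately show ?thesis using card_fixed_isotopism[OF L \<phi>L, where \<delta> = \<delta>] by blast
  qed
qed

section \<open>Upper bound for the squares with a symmetry\<close>

text \<open>For fixed \<open>\<phi>\<close>, the square is recovered from its orbit representatives
  as a union of orbits. Their number satisfies \<open>2 * card R \<le> n^2 + n^2 / 4\<close>, which
  is the bound in the set on the right.\<close>

lemma card_invariant_latin_squares:
  assumes "\<phi> \<noteq> (\<lambda>t\<in>triples n. t)" "4 \<le> n"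
  shows "card {L. latin_square n L \<and> \<phi> \<in> autoparatopisms n L}
    \<le> card {R. R \<subseteq> triples n \<and> 8 * card R \<le> 5 * n\<^sup>2}"
proof (rule surj_card_le)
  show "finite {R. R \<subseteq> triples n \<and> 8 * card R \<le> 5 * n\<^sup>2}" by simp
  show "{L. latin_square n L \<and> \<phi> \<in> autoparatopisms n L} \<subseteq>
    (\<lambda>R. \<Union>x\<in>R. range (\<lambda>k. (\<phi> ^^ k) x)) ` {R. R \<subseteq> triples n \<and> 8 * card R \<le> 5 * n\<^sup>2}"
  proof clarify
    fix L assume L: "latin_square n L" and \<phi>: "\<phi> \<in> autoparatopisms n L"
    have "finite L" "\<phi> ` L = L"
      using finite_subset[OF latin_square_subset[OF L]] \<phi> by (auto simp: autoparatopisms_def)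
    from orbit_representatives[OF this] obtain R where R: "R \<subseteq> L"
      "2 * card R \<le> card L + card {x\<in>L. \<phi> x = x}" "L = (\<Union>x\<in>R. range (\<lambda>k. (\<phi> ^^ k) x))" by blast
    have "8 * card R \<le> 5 * n\<^sup>2"
      using R(2) card_fixed_autoparatopism[OF L \<phi> assms] card_latin_square[OF L] by linarith
    then show "L \<in> (\<lambda>R. \<Union>x\<in>R. range (\<lambda>k. (\<phi> ^^ k) x)) ` {R. R \<subseteq> triples n \<and> 8 * card R \<le> 5 * n\<^sup>2}"
      using R(1,3) latin_square_subset[OF L] by blast
  qed
qed

lemma sum_power_card_Pow:
  fixes x :: real
  assumes "finite A"
  shows "(\<Sum>R\<in>Pow A. x ^ card R) = (1 + x) ^ card A"
  using prod_add[OF assms, of "\<lambda>_. x" "\<lambda>_. 1"] by (simp add: add.commute)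

text \<open>Exponential weighting: as \<open>x \<le> 1\<close>, every counted \<open>R\<close> has
  weight \<open>x powr (card R - m)\<close> at least 1, and over all subsets the weights sum to
  \<open>x powr (- m) * (1 + x) ^ card A\<close>.\<close>

lemma card_small_subsets:
  fixes x m :: real
  assumes "finite A" "x > 0" "x \<le> 1"
  shows "real (card {R. R \<subseteq> A \<and> real (card R) \<le> m}) \<le> x powr (- m) * exp (x * real (card A))"
proof -
  have "real (card {R. R \<subseteq> A \<and> real (card R) \<le> m}) = (\<Sum>R\<in>{R. R \<subseteq> A \<and> real (card R) \<le> m}. 1)"
    by simp
  also have "\<dots> \<le> (\<Sum>R\<in>{R. R \<subseteq> A \<and> real (card R) \<le> m}. x powr (- m) * x ^ card R)"
  proof (rule sum_mono)
    fix R assume "R \<in> {R. R \<subseteq> A \<and> real (card R) \<le> m}"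
    then have "1 \<le> x powr (real (card R) - m)"
      using assms powr_mono'[of "real (card R) - m" 0 x] by simp
    then show "1 \<le> x powr (- m) * x ^ card R"
      using assms(2) by (simp add: powr_realpow[symmetric] powr_add[symmetric] algebra_simps)
  qed
  also have "\<dots> \<le> (\<Sum>R\<in>Pow A. x powr (- m) * x ^ card R)"
    using assms by (intro sum_mono2) auto
  also have "\<dots> = x powr (- m) * (1 + x) ^ card A"
    by (simp add: sum_power_card_Pow[OF assms(1)] sum_distrib_left[symmetric])
  also have "\<dots> \<le> x powr (- m) * exp x ^ card A"
    using assms by (intro mult_left_mono power_mono) auto
  also have "exp x ^ card A = exp (x * real (card A))"
    by (simp add: exp_of_nat_mult[symmetric] mult.commute)
  finally show ?thesis .
qed

lemma UNIV_axis: "UNIV = {Row, Col, Sym}"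
  using axis.exhaust by auto

instance axis :: finite
  by standard (simp add: UNIV_axis)

lemma finite_card_paratopisms: "finite (paratopisms n) \<and> card (paratopisms n) \<le> 27 * n ^ (3 * n)"
proof -
  let ?P = "{p. p permutes {1..n}}"
  let ?D = "?P \<times> ?P \<times> ?P \<times> (UNIV :: (axis \<Rightarrow> axis) set)"
  let ?h = "\<lambda>(\<alpha>, \<beta>, \<gamma>, \<pi>). restrict (isotopism \<alpha> \<beta> \<gamma> \<circ> conjugation \<pi>) (triples n)"
  have fin: "finite ?D" by (simp add: finite_permutations)
  have sub: "paratopisms n \<subseteq> ?h ` ?D"
    by (auto simp: paratopisms_def image_iff) blast
  have P: "card ?P = fact n" using card_permutations[of "{1..n}" n] by simp
  \<comment> \<open>The value is \<open>3 ^ 3\<close>: all self-maps of the axes are counted, a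
    crude bound for the six bijections.\<close>
  have "card (UNIV :: (axis \<Rightarrow> axis) set) = 27"
    using card_PiE[of "UNIV :: axis set" "\<lambda>_. UNIV :: axis set"]
    by (simp only: PiE_UNIV_domain Pi_UNIV finite) (simp add: UNIV_axis)
  then have "card ?D = 27 * fact n ^ 3"
    by (simp only: card_cartesian_product P power3_eq_cube)
  also have "\<dots> \<le> 27 * (n ^ n) ^ 3"
    using fact_le_power[of n, where 'a = nat] by (intro mult_left_mono power_mono) auto
  finally have "card ?D \<le> 27 * n ^ (3 * n)" by (simp add: power_mult[symmetric] mult.commute)
  then show ?thesis
    using finite_subset[OF sub] surj_card_le[OF fin sub] fin by (meson finite_imageI le_trans)
qed

text \<open>Union bound over the non-identity paratopisms: the identity is always an autoparatopism,
  so a non-trivial group contains another one.\<close>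

lemma card_symmetric_latin_squares:
  assumes "4 \<le> n"
  shows "real (card {L. latin_square n L \<and> \<not> trivial_group (autoparatopy_group n L)})
    \<le> 27 * real n ^ (3 * n) * (real n powr (5 * real n ^ 2 / 8) * exp (real n ^ 2))"
proof -
  define I where "I = (\<lambda>t\<in>triples n. t)"
  define B where "B = card {R. R \<subseteq> triples n \<and> 8 * card R \<le> 5 * n\<^sup>2}"
  let ?U = "\<Union>\<phi>\<in>paratopisms n - {I}. {L. latin_square n L \<and> \<phi> \<in> autoparatopisms n L}"
  have finL: "finite {L. latin_square n L}"
    by (rule finite_subset[of _ "Pow (triples n)"]) (auto dest: latin_square_subset)
  have sub: "{L. latin_square n L \<and> \<not> trivial_group (autoparatopy_group n L)} \<subseteq> ?U"
  proof clarify
    fix L assume L: "latin_square n L" "\<not> trivial_group (autoparatopy_group n L)"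
    have one: "\<one>\<^bsub>autoparatopy_group n L\<^esub> = I"
      by (simp add: autoparatopy_group_def BijGroup_def I_def)
    have carr: "carrier (autoparatopy_group n L) = autoparatopisms n L"
      by (simp add: autoparatopy_group_def)
    have "I \<in> autoparatopisms n L"
      using group.is_monoid[OF group_autoparatopy_group[OF L(1)]] monoid.one_closed one carr by metis
    moreover have "autoparatopisms n L \<noteq> {I}"
      using L group_autoparatopy_group[OF L(1)] one carr by (simp add: trivial_group_def)
    ultimately obtain \<phi> where "\<phi> \<in> autoparatopisms n L" "\<phi> \<noteq> I" by blast
    then show "L \<in> ?U" using L(1) by (auto simp: autoparatopisms_def)
  qed
  have "card {L. latin_square n L \<and> \<not> trivial_group (autoparatopy_group n L)} \<le> card ?U"
    using finite_card_paratopisms finL by (intro card_mono sub finite_UN_I) (auto intro: finite_subset[OF _ finL])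
  also have "\<dots> \<le> (\<Sum>\<phi>\<in>paratopisms n - {I}. card {L. latin_square n L \<and> \<phi> \<in> autoparatopisms n L})"
    using finite_card_paratopisms by (intro card_UN_le) auto
  also have "\<dots> \<le> (\<Sum>\<phi>\<in>paratopisms n - {I}. B)"
    unfolding B_def I_def using assms by (intro sum_mono card_invariant_latin_squares) auto
  also have "\<dots> \<le> card (paratopisms n) * B"
    using finite_card_paratopisms by (simp add: card_Diff1_le)
  also have "\<dots> \<le> 27 * n ^ (3 * n) * B"
    using finite_card_paratopisms by (intro mult_right_mono) auto
  finally have 1: "real (card {L. latin_square n L \<and> \<not> trivial_group (autoparatopy_group n L)})
    \<le> real (27 * n ^ (3 * n) * B)" by (rule of_nat_mono)
  have "B = card {R. R \<subseteq> triples n \<and> real (card R) \<le> 5 * real n ^ 2 / 8}"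
  proof -
    have "8 * k \<le> 5 * n\<^sup>2 \<longleftrightarrow> real k \<le> 5 * real n ^ 2 / 8" for k
    proof -
      have "8 * k \<le> 5 * n\<^sup>2 \<longleftrightarrow> real (8 * k) \<le> real (5 * n\<^sup>2)" by (rule of_nat_le_iff[symmetric])
      then show ?thesis by (simp add: mult.commute)
    qed
    then show ?thesis by (simp add: B_def)
  qed
  \<comment> \<open>The weight \<open>x = 1 / n\<close> makes \<open>x * n^3\<close> equal to
    \<open>n^2\<close>, so the exponential factor has lower order than the main factor
    \<open>n powr (5 n^2 / 8)\<close>.\<close>
  also have "real \<dots> \<le> (1 / real n) powr (- (5 * real n ^ 2 / 8)) * exp (1 / real n * real (card (triples n)))"
    using assms by (intro card_small_subsets) auto
  also have "1 / real n * real (card (triples n)) = real n ^ 2"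
    using assms by (simp add: card_triples power2_eq_square power3_eq_cube)
  also have "(1 / real n) powr (- (5 * real n ^ 2 / 8)) = real n powr (5 * real n ^ 2 / 8)"
    using assms by (simp add: powr_divide powr_minus field_simps)
  finally have "real B \<le> real n powr (5 * real n ^ 2 / 8) * exp (real n ^ 2)" .
  then have "real (27 * n ^ (3 * n)) * real B \<le> real (27 * n ^ (3 * n)) * (real n powr (5 * real n ^ 2 / 8) * exp (real n ^ 2))"
    by (rule mult_left_mono) simp
  then show ?thesis using 1 by simp
qed

section \<open>Regular factors of regular bipartite graphs\<close>

text \<open>The Halmos-Vaughan induction. A tight non-empty proper subfamily is matched first, and
  the rest is matched into the values outside its neighbourhood. If there is none, an arbitrary
  value can be given to one index without destroying the condition.\<close>

lemma hall_marriage: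
  assumes "finite I" "\<And>i. i \<in> I \<Longrightarrow> finite (N i)"
    and "\<And>J. J \<subseteq> I \<Longrightarrow> card J \<le> card (\<Union>(N ` J))"
  shows "\<exists>f. inj_on f I \<and> (\<forall>i\<in>I. f i \<in> N i)"
  using assms
proof (induction I arbitrary: N rule: finite_psubset_induct)
  case (psubset I)
  have finN: "finite (\<Union>(N ` J))" if "J \<subseteq> I" for J
    using that psubset.hyps psubset.prems(1) finite_subset by blast
  show ?case
  proof (cases "\<exists>J. J \<subset> I \<and> J \<noteq> {} \<and> card (\<Union>(N ` J)) = card J")
    case True
    then obtain J where J: "J \<subset> I" "J \<noteq> {}" "card (\<Union>(N ` J)) = card J" by blast
    let ?U = "\<Union>(N ` J)"
    have finJ: "finite J" using J(1) psubset.hyps finite_subset by blast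
    have "\<exists>f. inj_on f J \<and> (\<forall>i\<in>J. f i \<in> N i)"
      using psubset.prems J(1) by (intro psubset.IH[OF J(1)]) auto
    then obtain f where f: "inj_on f J" "\<And>i. i \<in> J \<Longrightarrow> f i \<in> N i" by blast
    have "\<exists>g. inj_on g (I - J) \<and> (\<forall>i\<in>I - J. g i \<in> N i - ?U)"
    proof (rule psubset.IH)
      show "I - J \<subset> I" using J by blast
      show "finite (N i - ?U)" if "i \<in> I - J" for i using that psubset.prems(1) by auto
      fix K assume K: "K \<subseteq> I - J"
      have finK: "finite K" using K psubset.hyps finite_subset by blast
      have eq: "(\<Union>i\<in>K. N i - ?U) = \<Union>(N ` (K \<union> J)) - ?U" by auto
      \<comment> \<open>Hall's condition for \<open>K\<close> after deleting \<open>?U\<close>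
        follows from the condition for \<open>K \<union> J\<close>, since exactly
        \<open>card J\<close> values are deleted.\<close>
      have "card K + card J = card (K \<union> J)"
        using K finK finJ by (subst card_Un_disjoint) auto
      also have "\<dots> \<le> card (\<Union>(N ` (K \<union> J)))" using K J(1) by (intro psubset.prems(2)) blast
      also have "\<dots> = card (\<Union>i\<in>K. N i - ?U) + card J"
      proof -
        have "finite (\<Union>(N ` (K \<union> J)))" using K J(1) by (intro finN) blast
        moreover have "?U \<subseteq> \<Union>(N ` (K \<union> J))" by auto
        ultimately show ?thesis
          unfolding eq using J(3) card_mono card_Diff_subset finite_subset
          by (metis le_add_diff_inverse2)
      qed
      finally show "card K \<le> card (\<Union>i\<in>K. N i - ?U)" by simp
    qed
    then obtain g where g: "inj_on g (I - J)" "\<And>i. i \<in> I - J \<Longrightarrow> g i \<in> N i - ?U" by blast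
    let ?h = "\<lambda>i. if i \<in> J then f i else g i"
    have "inj_on ?h I"
    proof (rule inj_onI)
      fix x y assume xy: "x \<in> I" "y \<in> I" "?h x = ?h y"
      have "f x \<in> ?U" if "x \<in> J" for x using f(2) that by blast
      then show "x = y"
        using xy f(1) g(1) g(2)[of x] g(2)[of y]
        by (cases "x \<in> J"; cases "y \<in> J") (auto dest: inj_onD, metis+)
    qed
    moreover have "\<forall>i\<in>I. ?h i \<in> N i" using f(2) g(2) by auto
    ultimately show ?thesis by blast
  next
    case False
    show ?thesis
    proof (cases "I = {}")
      case True
      then show ?thesis by simp
    next
      case nonempty: False
      then obtain i where i: "i \<in> I" by blast
      have "card {i} \<le> card (\<Union>(N ` {i}))" using i by (intro psubset.prems(2)) auto
      then obtain x where x: "x \<in> N i" by fastforce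
      have "\<exists>g. inj_on g (I - {i}) \<and> (\<forall>j\<in>I - {i}. g j \<in> N j - {x})"
      proof (rule psubset.IH)
        show "I - {i} \<subset> I" using i by blast
        show "finite (N j - {x})" if "j \<in> I - {i}" for j using that psubset.prems(1) by auto
        fix K assume K: "K \<subseteq> I - {i}"
        show "card K \<le> card (\<Union>j\<in>K. N j - {x})"
        proof (cases "K = {}")
          case nK: False
          have "K \<subset> I" using K i by blast
          \<comment> \<open>No proper non-empty subfamily is tight, and this slack of one pays for
            deleting \<open>x\<close>.\<close>
          then have "card K < card (\<Union>(N ` K))"
            using False nK psubset.prems(2)[of K] by (metis order_le_less psubset_imp_subset)
          moreover have "(\<Union>j\<in>K. N j - {x}) = \<Union>(N ` K) - {x}" by auto
          ultimately show ?thesis by (simp add: card_Diff_singleton_if) linarith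
        qed simp
      qed
      then obtain g where g: "inj_on g (I - {i})" "\<And>j. j \<in> I - {i} \<Longrightarrow> g j \<in> N j - {x}" by blast
      have "inj_on (g(i := x)) I"
        using g by (auto simp: inj_on_def)
      moreover have "\<forall>j\<in>I. (g(i := x)) j \<in> N j" using g(2) x by auto
      ultimately show ?thesis by blast
    qed
  qed
qed

section \<open>Regular bipartite graphs and perfect matchings\<close>

text \<open>Vertices live in a sum type, so that both sides are handled by one quantifier and stay
  disjoint even when rows and columns are both \<open>{1..n}\<close>.\<close>

definition star :: "('a \<times> 'b) set \<Rightarrow> 'a + 'b \<Rightarrow> ('a \<times> 'b) set" where
  "star E v = {e \<in> E. v = Inl (fst e) \<or> v = Inr (snd e)}"

definition regular_bipartite :: "'a set \<Rightarrow> 'b set \<Rightarrow> nat \<Rightarrow> ('a \<times> 'b) set \<Rightarrow> bool" where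
  "regular_bipartite A B d E \<longleftrightarrow> E \<subseteq> A \<times> B \<and> (\<forall>v\<in>A <+> B. card (star E v) = d)"

lemma star_subset: "star E v \<subseteq> E"
  by (auto simp: star_def)

lemma regular_bipartite_finite:
  "regular_bipartite A B d E \<Longrightarrow> finite A \<Longrightarrow> finite B \<Longrightarrow> finite E"
  unfolding regular_bipartite_def by (meson finite_SigmaI finite_subset)

lemma card_edges_at_left:
  assumes "regular_bipartite A B d E" "finite A" "finite B" "J \<subseteq> A"
  shows "card {e\<in>E. fst e \<in> J} = d * card J"
proof -
  have fin: "finite E" by (rule regular_bipartite_finite[OF assms(1-3)])
  have "{e\<in>E. fst e \<in> J} = (\<Union>a\<in>J. star E (Inl a))" by (auto simp: star_def)
  then have "card {e\<in>E. fst e \<in> J} = (\<Sum>a\<in>J. card (star E (Inl a)))"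
    using assms(2,4) finite_subset fin finite_subset[OF star_subset]
    by (simp, subst card_UN_disjoint) (auto simp: star_def)
  also have "\<dots> = (\<Sum>a\<in>J. d)"
    using assms(1,4) by (intro sum.cong) (auto simp: regular_bipartite_def)
  finally show ?thesis by simp
qed

lemma card_edges_at_right:
  assumes "regular_bipartite A B d E" "finite A" "finite B" "J \<subseteq> B"
  shows "card {e\<in>E. snd e \<in> J} = d * card J"
proof -
  have fin: "finite E" by (rule regular_bipartite_finite[OF assms(1-3)])
  have "{e\<in>E. snd e \<in> J} = (\<Union>a\<in>J. star E (Inr a))" by (auto simp: star_def)
  then have "card {e\<in>E. snd e \<in> J} = (\<Sum>a\<in>J. card (star E (Inr a)))"
    using assms(3,4) finite_subset fin finite_subset[OF star_subset]
    by (simp, subst card_UN_disjoint) (auto simp: star_def)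
  also have "\<dots> = (\<Sum>a\<in>J. d)"
    using assms(1,4) by (intro sum.cong) (auto simp: regular_bipartite_def)
  finally show ?thesis by simp
qed

lemma regular_bipartite_diff:
  assumes "regular_bipartite A B d E" "regular_bipartite A B k M" "M \<subseteq> E" "finite A" "finite B"
  shows "regular_bipartite A B (d - k) (E - M)"
proof -
  have "card (star (E - M) v) = d - k" if "v \<in> A <+> B" for v
  proof -
    have "star (E - M) v = star E v - star M v" by (auto simp: star_def)
    moreover have "star M v \<subseteq> star E v" using assms(3) by (auto simp: star_def)
    moreover have "finite (star M v)"
      using regular_bipartite_finite[OF assms(2,4,5)] star_subset finite_subset by metis
    ultimately show ?thesis using that assms(1,2) by (simp add: card_Diff_subset regular_bipartite_def)
  qed
  then show ?thesis using assms(1) by (auto simp: regular_bipartite_def)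
qed

text \<open>Double counting gives Hall's condition: the \<open>d * card J\<close> edges leaving
  \<open>J\<close> all end in its neighbourhood, which meets \<open>d\<close> edges per vertex.
  Counting all edges gives \<open>card A = card B\<close>, so the injection obtained is onto
  \<open>B\<close>.\<close>

lemma regular_bipartite_perfect_matching:
  assumes E: "regular_bipartite A B d E" and fin: "finite A" "finite B" and d: "0 < d"
  shows "\<exists>M\<subseteq>E. regular_bipartite A B 1 M"
proof -
  let ?N = "\<lambda>a. {b. (a, b) \<in> E}"
  have sub: "E \<subseteq> A \<times> B" using E by (simp add: regular_bipartite_def)
  have finE: "finite E" by (rule regular_bipartite_finite[OF E fin])
  have "d * card A = d * card B"
  proof -
    have "{e\<in>E. fst e \<in> A} = E" "{e\<in>E. snd e \<in> B} = E" using sub by auto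
    then show ?thesis
      using card_edges_at_left[OF E fin, of A] card_edges_at_right[OF E fin, of B] by simp
  qed
  then have card_eq: "card A = card B" using d by simp
  have "\<exists>f. inj_on f A \<and> (\<forall>a\<in>A. f a \<in> ?N a)"
  proof (rule hall_marriage[OF fin(1)])
    show "finite (?N a)" for a by (rule finite_subset[OF _ fin(2)]) (use sub in auto)
    fix J assume J: "J \<subseteq> A"
    have NB: "\<Union>(?N ` J) \<subseteq> B" using sub by auto
    have "d * card J = card {e\<in>E. fst e \<in> J}" by (simp add: card_edges_at_left[OF E fin J])
    also have "\<dots> \<le> card {e\<in>E. snd e \<in> \<Union>(?N ` J)}" using finE by (intro card_mono) auto
    also have "\<dots> = d * card (\<Union>(?N ` J))" by (rule card_edges_at_right[OF E fin NB])
    finally show "card J \<le> card (\<Union>(?N ` J))" using d by simp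
  qed
  then obtain f where f: "inj_on f A" "\<And>a. a \<in> A \<Longrightarrow> (a, f a) \<in> E" by blast
  have im: "f ` A = B"
    using card_image[OF f(1)] card_eq f(2) sub fin(2) by (intro card_subset_eq) auto
  define M where "M = (\<lambda>a. (a, f a)) ` A"
  have "card (star M v) = 1" if v: "v \<in> A <+> B" for v
  proof -
    obtain a where a: "a \<in> A" "v = Inl a \<or> v = Inr (f a)" using v im by auto
    then have "star M v = {(a, f a)}" using f(1) by (auto simp: star_def M_def dest: inj_onD)
    then show ?thesis by simp
  qed
  moreover have "M \<subseteq> E" using f(2) by (auto simp: M_def)
  ultimately show ?thesis using sub by (auto simp: regular_bipartite_def)
qed

text \<open>The union of two perfect matchings of a set is a union of even cycles. The induction contracts
  the path \<open>\<tau> e, e, \<sigma> e, \<tau> (\<sigma> e)\<close> to a single pair of \<open>\<tau>\<close>.\<close>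

lemma involutions_common_transversal:
  fixes \<sigma> \<tau> :: "'a \<Rightarrow> 'a"
  assumes "finite E"
    and "\<And>e. e \<in> E \<Longrightarrow> \<sigma> e \<in> E \<and> \<sigma> e \<noteq> e \<and> \<sigma> (\<sigma> e) = e"
    and "\<And>e. e \<in> E \<Longrightarrow> \<tau> e \<in> E \<and> \<tau> e \<noteq> e \<and> \<tau> (\<tau> e) = e"
  shows "\<exists>S\<subseteq>E. \<forall>e\<in>E. (\<sigma> e \<in> S) \<noteq> (e \<in> S) \<and> (\<tau> e \<in> S) \<noteq> (e \<in> S)"
  using assms
proof (induction E arbitrary: \<tau> rule: finite_psubset_induct)
  case (psubset E)
  note s = psubset.prems(1) and t = psubset.prems(2)
  show ?case
  proof (cases "E = {}")
    case True
    then show ?thesis by simp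
  next
    case False
    then obtain e where e: "e \<in> E" by blast
    define f where "f = \<sigma> e"
    define g where "g = \<tau> e"
    define h where "h = \<tau> f"
    have f: "f \<in> E" "f \<noteq> e" "\<sigma> f = e" using s[OF e] by (auto simp: f_def)
    have g: "g \<in> E" "g \<noteq> e" "\<tau> g = e" using t[OF e] by (auto simp: g_def)
    have h: "h \<in> E" "h \<noteq> f" "\<tau> h = f" using t[OF f(1)] by (auto simp: h_def)
    let ?E = "E - {e, f}"
    have s': "\<sigma> x \<in> ?E \<and> \<sigma> x \<noteq> x \<and> \<sigma> (\<sigma> x) = x" if "x \<in> ?E" for x
      using s[of x] that f f_def by auto
    have sub: "?E \<subset> E" using e by blast
    show ?thesis
    proof (cases "g = f")
      case True
      have t': "\<tau> x \<in> ?E \<and> \<tau> x \<noteq> x \<and> \<tau> (\<tau> x) = x" if "x \<in> ?E" for x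
        using t[of x] that True f g g_def by auto
      from psubset.IH[OF sub s' t'] obtain S where S: "S \<subseteq> ?E"
        "\<And>x. x \<in> ?E \<Longrightarrow> (\<sigma> x \<in> S) \<noteq> (x \<in> S) \<and> (\<tau> x \<in> S) \<noteq> (x \<in> S)" by blast
      have "(\<sigma> x \<in> insert e S) \<noteq> (x \<in> insert e S) \<and> (\<tau> x \<in> insert e S) \<noteq> (x \<in> insert e S)"
        if "x \<in> E" for x
      proof (cases "x \<in> {e, f}")
        case True
        then show ?thesis using \<open>g = f\<close> S(1) f g f_def g_def by auto
      next
        case False
        then have "x \<in> ?E" using that by blast
        then show ?thesis using S(2)[of x] s'[of x] t'[of x] by auto
      qed
      then show ?thesis using S(1) e by (intro exI[of _ "insert e S"]) auto
    next
      case gf: False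
      have "h \<noteq> e" using gf h(3) g_def by blast
      then have gh: "g \<in> ?E" "h \<in> ?E" "g \<noteq> h" using gf f g h by auto
      define \<tau>' where "\<tau>' = \<tau>(g := h, h := g)"
      have t': "\<tau>' x \<in> ?E \<and> \<tau>' x \<noteq> x \<and> \<tau>' (\<tau>' x) = x" if "x \<in> ?E" for x
        using t[of x] that gh g h g_def h_def by (auto simp: \<tau>'_def)
      from psubset.IH[OF sub s' t'] obtain S where S: "S \<subseteq> ?E"
        "\<And>x. x \<in> ?E \<Longrightarrow> (\<sigma> x \<in> S) \<noteq> (x \<in> S) \<and> (\<tau>' x \<in> S) \<noteq> (x \<in> S)" by blast
      have Sgh: "(g \<in> S) \<noteq> (h \<in> S)" using S(2)[OF gh(1)] gh(3) by (auto simp: \<tau>'_def)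
      \<comment> \<open>Since \<open>S\<close> contains exactly one of \<open>g\<close> and
        \<open>h\<close>, the new element can be chosen opposite to both: if \<open>g\<close> is in
        \<open>S\<close>, then \<open>f\<close> is added and \<open>h\<close> is absent; otherwise
        \<open>e\<close> is added and \<open>h\<close> is present.\<close>
      define S' where "S' = (if g \<in> S then insert f S else insert e S)"
      have S'[simp]: "x \<in> S' \<longleftrightarrow> (if x = e then g \<notin> S else if x = f then g \<in> S else x \<in> S)" for x
        using S(1) f(2) by (auto simp: S'_def)
      have "(\<sigma> x \<in> S') \<noteq> (x \<in> S') \<and> (\<tau> x \<in> S') \<noteq> (x \<in> S')" if xE: "x \<in> E" for x
      proof -
        consider "x = e" | "x = f" | "x = g" | "x = h" | "x \<in> ?E" "x \<noteq> g" "x \<noteq> h" using xE by blast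
        then show ?thesis
        proof cases
          case 1
          then show ?thesis using gh f f_def g_def by auto
        next
          case 2
          then show ?thesis using gh f Sgh h_def by auto
        next
          case 3
          then show ?thesis using gh g S(2)[OF gh(1)] s'[OF gh(1)] by auto
        next
          case 4
          then show ?thesis using gh h f Sgh S(2)[OF gh(2)] s'[OF gh(2)] by auto
        next
          case 5
          have "\<tau> x \<noteq> e" "\<tau> x \<noteq> f" using 5 t[OF xE] g_def h_def by auto
          then show ?thesis using 5 S(2)[OF 5(1)] s'[OF 5(1)] by (auto simp: \<tau>'_def)
        qed
      qed
      moreover have "S' \<subseteq> E" using S(1) e f by (auto simp: S'_def)
      ultimately show ?thesis by blast
    qed
  qed
qed

section \<open>Pairing consecutive entries of a list\<close>

text \<open>An element outside the list, or the unpaired last entry of a list of odd length, is its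
  own partner; hence the even lengths assumed below.\<close>

fun partner :: "'a list \<Rightarrow> 'a \<Rightarrow> 'a" where
  "partner (x # y # zs) e = (if e = x then y else if e = y then x else partner zs e)"
| "partner _ e = e"

text \<open>Only the disjoint pairs of positions are compared: the word
  \<open>[True, False, False, True]\<close> qualifies.\<close>

fun alternating :: "bool list \<Rightarrow> bool" where
  "alternating [] \<longleftrightarrow> True"
| "alternating [_] \<longleftrightarrow> False"
| "alternating (b # c # bs) \<longleftrightarrow> b \<noteq> c \<and> alternating bs"

lemma partner_props:
  assumes "distinct xs" "even (length xs)" "e \<in> set xs"
  shows "partner xs e \<in> set xs \<and> partner xs e \<noteq> e \<and> partner xs (partner xs e) = e"
  using assms by (induction xs e rule: partner.induct) auto

lemma alternating_partner:
  assumes "distinct xs" "even (length xs)" "\<And>e. e \<in> set xs \<Longrightarrow> P (partner xs e) \<noteq> P e"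
  shows "alternating (map P xs)"
  using assms
proof (induction "map P xs" arbitrary: xs rule: alternating.induct)
  case (3 b c bs)
  then obtain x y zs where xs: "xs = x # y # zs" by (auto simp: Cons_eq_map_conv)
  have "alternating (map P zs)"
  proof (rule 3(1))
    show "bs = map P zs" "distinct zs" "even (length zs)" using 3 xs by auto
    fix e assume "e \<in> set zs"
    then show "P (partner zs e) \<noteq> P e" using 3(5)[of e] 3(3) xs by (auto split: if_splits)
  qed
  moreover have "P x \<noteq> P y" using 3(5)[of x] xs by auto
  ultimately show ?case by (simp add: xs)
qed auto

lemma alternating_count:
  "alternating (map P xs) \<Longrightarrow> 2 * length (filter P xs) = length xs"
  by (induction "map P xs" arbitrary: xs rule: alternating.induct) (auto simp: Cons_eq_map_conv)

text \<open>The first bit of each of the \<open>k\<close> pairs determines the second.\<close>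

lemma card_alternating: "card {bs. alternating bs \<and> length bs = 2 * k} \<le> 2 ^ k"
proof (induction k)
  case 0
  have "{bs. alternating bs \<and> length bs = 2 * 0} = {[]}" by auto
  then show ?case by simp
next
  case (Suc k)
  let ?A = "\<lambda>k. {bs. alternating bs \<and> length bs = 2 * k}"
  have fin: "finite (?A k)"
    by (rule finite_subset[OF _ finite_lists_length_eq[of UNIV "2 * k"]]) auto
  have "?A (Suc k) \<subseteq> (\<lambda>(b, bs). b # (\<not> b) # bs) ` (UNIV \<times> ?A k)"
  proof
    fix bs assume "bs \<in> ?A (Suc k)"
    then show "bs \<in> (\<lambda>(b, bs). b # (\<not> b) # bs) ` (UNIV \<times> ?A k)"
      by (cases bs rule: alternating.cases) (auto simp: image_iff)
  qed
  then have "card (?A (Suc k)) \<le> card ((UNIV :: bool set) \<times> ?A k)"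
    using fin by (intro surj_card_le) auto
  then show ?case using Suc by (simp add: card_cartesian_product)
qed

text \<open>A list is a shuffle of its two filtered sublists, and the word of bits tells which
  sublist supplies the next entry.\<close>

lemma filter_map_eq_imp_eq:
  assumes "filter P xs = filter P ys" "filter (\<lambda>x. \<not> P x) xs = filter (\<lambda>x. \<not> P x) ys"
    "map P xs = map P ys"
  shows "xs = ys"
  using assms
proof (induction xs arbitrary: ys)
  case (Cons x xs)
  then obtain y ys' where "ys = y # ys'" by (cases ys) auto
  then show ?case using Cons by (auto split: if_splits)
qed simp

definition balanced_lists :: "'a set \<Rightarrow> 'a set \<Rightarrow> 'a list set" where
  "balanced_lists T S = {xs \<in> permutations_of_set T. alternating (map (\<lambda>x. x \<in> S) xs)}"

text \<open>The three factors count the order induced on \<open>T \<inter> S\<close>, the order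
  induced on \<open>T - S\<close>, and the alternating word of membership bits; together they
  determine the list.\<close>

lemma card_balanced_lists:
  assumes "finite T" "card T = 2 * k" "card (T \<inter> S) = k"
  shows "card (balanced_lists T S) \<le> fact k * fact k * 2 ^ k"
proof -
  let ?h = "\<lambda>xs. (filter (\<lambda>x. x \<in> S) xs, filter (\<lambda>x. x \<notin> S) xs, map (\<lambda>x. x \<in> S) xs)"
  let ?D = "permutations_of_set (T \<inter> S) \<times> permutations_of_set (T - S) \<times>
    {bs. alternating bs \<and> length bs = 2 * k}"
  have fin: "finite {bs. alternating bs \<and> length bs = 2 * k}"
    by (rule finite_subset[OF _ finite_lists_length_eq[of UNIV "2 * k"]]) auto
  have "card (T - S) = k"
    using assms card_Diff_subset_Int[of T S] by simp
  have "inj_on ?h (balanced_lists T S)"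
    by (rule inj_onI) (auto intro: filter_map_eq_imp_eq[of "\<lambda>x. x \<in> S"])
  moreover have "?h ` balanced_lists T S \<subseteq> ?D"
    using assms(2) by (auto simp: balanced_lists_def permutations_of_set_def distinct_card[symmetric])
  ultimately have "card (balanced_lists T S) \<le> card ?D"
    using assms(1) fin by (intro card_inj_on_le) auto
  also have "\<dots> = fact k * (fact k * card {bs. alternating bs \<and> length bs = 2 * k})"
    using assms \<open>card (T - S) = k\<close> by (simp add: card_cartesian_product)
  also have "\<dots> \<le> fact k * (fact k * 2 ^ k)"
    by (intro mult_left_mono card_alternating) auto
  finally show ?thesis by (simp add: mult.assoc)
qed

text \<open>An alternating word is true in exactly half of its positions. Applied at every vertex,
  this makes an evenly splitting \<open>S\<close> a \<open>k\<close>-factor.\<close>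

lemma balanced_lists_card:
  assumes "xs \<in> balanced_lists T S"
  shows "2 * card (T \<inter> S) = card T"
proof -
  have xs: "distinct xs" "set xs = T" "alternating (map (\<lambda>x. x \<in> S) xs)"
    using assms by (auto simp: balanced_lists_def permutations_of_set_def)
  have "T \<inter> S = set (filter (\<lambda>x. x \<in> S) xs)" using xs by auto
  then have "card (T \<inter> S) = length (filter (\<lambda>x. x \<in> S) xs)"
    using xs(1) by (metis distinct_card distinct_filter)
  then show ?thesis using alternating_count[OF xs(3)] xs(1,2) distinct_card by metis
qed

text \<open>Schrijver's argument: list the edges at every vertex and pair up consecutive ones. By
  \<open>involutions_common_transversal\<close> every such choice is split evenly by some \<open>k\<close>-factor, and
  each \<open>k\<close>-factor splits at most \<open>(k!\<^sup>2 2\<^sup>k)\<^bsup>2n\<^esup>\<close> choices.\<close>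

lemma card_half_factors:
  assumes E: "regular_bipartite A B (2 * k) E" and fin: "finite A" "finite B"
    and card: "card A = n" "card B = n"
  shows "fact (2 * k) ^ (2 * n)
    \<le> card {S. S \<subseteq> E \<and> regular_bipartite A B k S} * (fact k * fact k * 2 ^ k) ^ (2 * n)"
proof -
  let ?V = "A <+> B"
  let ?F = "{S. S \<subseteq> E \<and> regular_bipartite A B k S}"
  have finE: "finite E" by (rule regular_bipartite_finite[OF E fin])
  have finst: "finite (star E v)" for v using finE star_subset finite_subset by metis
  have cst: "card (star E v) = 2 * k" if "v \<in> ?V" for v using E that by (simp add: regular_bipartite_def)
  have finV: "finite ?V" and cV: "card ?V = 2 * n" using fin card by (auto simp: card_Plus)
  have finF: "finite ?F" using finE by simp
  let ?X = "PiE ?V (\<lambda>v. permutations_of_set (star E v))"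
  let ?Y = "\<lambda>S. PiE ?V (\<lambda>v. balanced_lists (star E v) S)"
  have finY: "finite (?Y S)" for S
    using finV finst by (intro finite_PiE) (auto simp: balanced_lists_def)
  have "?X \<subseteq> (\<Union>S\<in>?F. ?Y S)"
  proof
    fix l assume l: "l \<in> ?X"
    have lv: "distinct (l v)" "set (l v) = star E v" "even (length (l v))" if "v \<in> ?V" for v
    proof -
      show 1: "distinct (l v)" "set (l v) = star E v"
        using PiE_mem[OF l that] by (auto simp: permutations_of_set_def)
      show "even (length (l v))" using distinct_card[OF 1(1)] 1(2) cst[OF that] by (metis dvd_triv_left)
    qed
    \<comment> \<open>Every edge has one left and one right end, so the pairings at the left
      vertices assemble into one involution of \<open>E\<close>, and those at the right vertices
      into another.\<close>
    define \<sigma> where "\<sigma> e = partner (l (Inl (fst e))) e" for e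
    define \<tau> where "\<tau> e = partner (l (Inr (snd e))) e" for e
    have EV: "Inl (fst e) \<in> ?V" "Inr (snd e) \<in> ?V" if "e \<in> E" for e
      using E that by (auto simp: regular_bipartite_def)
    have s: "\<sigma> e \<in> E \<and> \<sigma> e \<noteq> e \<and> \<sigma> (\<sigma> e) = e" if "e \<in> E" for e
    proof -
      let ?v = "Inl (fst e) :: 'a + 'b"
      have "e \<in> set (l ?v)" using lv(2)[OF EV(1)[OF that]] that by (simp add: star_def)
      from partner_props[OF lv(1)[OF EV(1)[OF that]] lv(3)[OF EV(1)[OF that]] this]
      have "\<sigma> e \<in> star E ?v" "\<sigma> e \<noteq> e" "partner (l ?v) (\<sigma> e) = e"
        using lv(2)[OF EV(1)[OF that]] by (auto simp: \<sigma>_def)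
      moreover have "fst (\<sigma> e) = fst e" using calculation(1) by (auto simp: star_def)
      ultimately show ?thesis using star_subset unfolding \<sigma>_def by auto
    qed
    have t: "\<tau> e \<in> E \<and> \<tau> e \<noteq> e \<and> \<tau> (\<tau> e) = e" if "e \<in> E" for e
    proof -
      let ?v = "Inr (snd e) :: 'a + 'b"
      have "e \<in> set (l ?v)" using lv(2)[OF EV(2)[OF that]] that by (simp add: star_def)
      from partner_props[OF lv(1)[OF EV(2)[OF that]] lv(3)[OF EV(2)[OF that]] this]
      have "\<tau> e \<in> star E ?v" "\<tau> e \<noteq> e" "partner (l ?v) (\<tau> e) = e"
        using lv(2)[OF EV(2)[OF that]] by (auto simp: \<tau>_def)
      moreover have "snd (\<tau> e) = snd e" using calculation(1) by (auto simp: star_def)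
      ultimately show ?thesis using star_subset unfolding \<tau>_def by auto
    qed
    obtain S where S: "S \<subseteq> E" "\<And>e. e \<in> E \<Longrightarrow> (\<sigma> e \<in> S) \<noteq> (e \<in> S) \<and> (\<tau> e \<in> S) \<noteq> (e \<in> S)"
      using involutions_common_transversal[OF finE s t] by blast
    have bal: "l v \<in> balanced_lists (star E v) S" if v: "v \<in> ?V" for v
    proof -
      have "alternating (map (\<lambda>x. x \<in> S) (l v))"
      proof (rule alternating_partner[OF lv(1,3)[OF v]])
        fix e assume "e \<in> set (l v)"
        then have "e \<in> star E v" using lv(2)[OF v] by simp
        then have "e \<in> E" "partner (l v) e = \<sigma> e \<or> partner (l v) e = \<tau> e"
          by (auto simp: star_def \<sigma>_def \<tau>_def)
        then show "(partner (l v) e \<in> S) \<noteq> (e \<in> S)" using S(2) by metis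
      qed
      then show ?thesis using PiE_mem[OF l v] by (simp add: balanced_lists_def)
    qed
    have "card (star S v) = k" if "v \<in> ?V" for v
    proof -
      have "star S v = star E v \<inter> S" using S(1) by (auto simp: star_def)
      then show ?thesis using balanced_lists_card[OF bal[OF that]] cst[OF that] by simp
    qed
    then have "S \<in> ?F" using S(1) E by (auto simp: regular_bipartite_def)
    moreover have "l \<in> ?Y S" using l bal by (auto simp: PiE_iff)
    ultimately show "l \<in> (\<Union>S\<in>?F. ?Y S)" by blast
  qed
  then have "card ?X \<le> card (\<Union>S\<in>?F. ?Y S)"
    using finF finY by (intro card_mono) auto
  also have "\<dots> \<le> (\<Sum>S\<in>?F. card (?Y S))" by (rule card_UN_le[OF finF])
  also have "\<dots> \<le> (\<Sum>S\<in>?F. (fact k * fact k * 2 ^ k) ^ (2 * n))"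
  proof (rule sum_mono)
    fix S assume S: "S \<in> ?F"
    have "card (?Y S) = (\<Prod>v\<in>?V. card (balanced_lists (star E v) S))" using finV by (simp add: card_PiE)
    also have "\<dots> \<le> (\<Prod>v\<in>?V. fact k * fact k * 2 ^ k)"
    proof (rule prod_mono)
      fix v assume v: "v \<in> ?V"
      have "star E v \<inter> S = star S v" using S by (auto simp: star_def)
      then have "card (star E v \<inter> S) = k" using S v by (auto simp: regular_bipartite_def)
      then show "0 \<le> card (balanced_lists (star E v) S) \<and>
        card (balanced_lists (star E v) S) \<le> fact k * fact k * 2 ^ k"
        using card_balanced_lists[OF finst cst[OF v]] by simp
    qed
    finally show "card (?Y S) \<le> (fact k * fact k * 2 ^ k) ^ (2 * n)" by (simp add: cV)
  qed
  finally have "card ?X \<le> card ?F * (fact k * fact k * 2 ^ k) ^ (2 * n)" by simp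
  moreover have "card ?X = fact (2 * k) ^ (2 * n)"
    using finV by (simp add: card_PiE finst cst cV)
  ultimately show ?thesis by simp
qed

section \<open>Proper edge colourings\<close>

definition proper_colourings :: "('a \<times> 'b) set \<Rightarrow> 'c set \<Rightarrow> ('a \<times> 'b \<Rightarrow> 'c) set" where
  "proper_colourings E S = {f \<in> E \<rightarrow>\<^sub>E S. \<forall>v. inj_on f (star E v)}"

lemma finite_proper_colourings: "finite E \<Longrightarrow> finite S \<Longrightarrow> finite (proper_colourings E S)"
  unfolding proper_colourings_def by (rule finite_subset[of _ "E \<rightarrow>\<^sub>E S"]) (auto intro: finite_PiE)

text \<open>Colourings of \<open>M\<close> and \<open>E - M\<close> from disjoint palettes glue to a
  proper colouring. Gluing is injective even as \<open>M\<close> varies, because \<open>M\<close> is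
  recovered as the set of edges coloured from \<open>S\<close>.\<close>

lemma proper_colourings_split:
  assumes E: "finite E" and S: "finite S" "finite T" "S \<inter> T = {}" and F: "\<And>M. M \<in> F \<Longrightarrow> M \<subseteq> E"
  shows "(\<Sum>M\<in>F. card (proper_colourings M S) * card (proper_colourings (E - M) T))
    \<le> card (proper_colourings E (S \<union> T))"
proof -
  let ?D = "SIGMA M:F. proper_colourings M S \<times> proper_colourings (E - M) T"
  let ?h = "\<lambda>(M, f, g). \<lambda>e\<in>E. if e \<in> M then f e else g e"
  have finF: "finite F" using F by (intro finite_subset[OF _ finite_Pow_iff[THEN iffD2, OF E]]) auto
  have finM: "finite M" if "M \<in> F" for M using F[OF that] E finite_subset by blast
  have in_S: "f e \<in> S" if "f \<in> proper_colourings M S" "e \<in> M" for f e M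
    using that by (auto simp: proper_colourings_def)
  have in_T: "g e \<in> T" if "g \<in> proper_colourings (E - M) T" "e \<in> E" "e \<notin> M" for g e M
    using that by (auto simp: proper_colourings_def)
  have "?h ` ?D \<subseteq> proper_colourings E (S \<union> T)"
  proof clarify
    fix M f g assume M: "M \<in> F" and f: "f \<in> proper_colourings M S"
      and g: "g \<in> proper_colourings (E - M) T"
    let ?c = "\<lambda>e\<in>E. if e \<in> M then f e else g e"
    have "inj_on ?c (star E v)" for v
    proof (rule inj_onI)
      fix x y assume x: "x \<in> star E v" and y: "y \<in> star E v" and eq: "?c x = ?c y"
      have xy: "x \<in> E" "y \<in> E" using x y by (auto simp: star_def)
      show "x = y"
      proof (cases "x \<in> M \<longleftrightarrow> y \<in> M")
        case True
        show ?thesis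
        proof (cases "x \<in> M")
          case xM: True
          then have "x \<in> star M v" "y \<in> star M v" using True x y by (auto simp: star_def)
          moreover have "f x = f y" using eq xy xM True by simp
          ultimately show ?thesis using f by (auto simp: proper_colourings_def dest: inj_onD)
        next
          case xM: False
          then have "x \<in> star (E - M) v" "y \<in> star (E - M) v" using True x y by (auto simp: star_def)
          moreover have "g x = g y" using eq xy xM True by simp
          ultimately show ?thesis using g by (auto simp: proper_colourings_def dest: inj_onD)
        qed
      next
        case False
        then show ?thesis
          using eq xy in_S[OF f, of x] in_S[OF f, of y] in_T[OF g, of x] in_T[OF g, of y] S(3)
          by (auto split: if_splits)
      qed
    qed
    moreover have "?c \<in> E \<rightarrow>\<^sub>E S \<union> T" using in_S[OF f] in_T[OF g] by auto
    ultimately show "?c \<in> proper_colourings E (S \<union> T)" by (simp add: proper_colourings_def)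
  qed
  moreover have "inj_on ?h ?D"
  proof (rule inj_onI)
    fix x y assume xy: "x \<in> ?D" "y \<in> ?D" "?h x = ?h y"
    obtain M f g M' f' g' where x: "x = (M, f, g)" and y: "y = (M', f', g')" by (metis prod_cases3)
    have M: "M \<in> F" "M' \<in> F"
      and f: "f \<in> proper_colourings M S" "f' \<in> proper_colourings M' S"
      and g: "g \<in> proper_colourings (E - M) T" "g' \<in> proper_colourings (E - M') T"
      using xy(1,2) by (auto simp: x y)
    have eq: "(\<lambda>e\<in>E. if e \<in> M then f e else g e) = (\<lambda>e\<in>E. if e \<in> M' then f' e else g' e)"
      using xy(3) by (simp only: x y prod.case)
    have eq': "(if e \<in> M then f e else g e) = (if e \<in> M' then f' e else g' e)" if "e \<in> E" for e
      using fun_cong[OF eq, of e] that by simp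
    have "e \<in> M \<longleftrightarrow> e \<in> M'" if "e \<in> E" for e
      using eq'[OF that] that in_S[OF f(1), of e] in_S[OF f(2), of e] in_T[OF g(1), of e]
        in_T[OF g(2), of e] S(3) by (auto split: if_splits)
    then have MM: "M' = M" using F[OF M(1)] F[OF M(2)] by blast
    have "f e = f' e" for e
    proof (cases "e \<in> M")
      case True
      then have "e \<in> E" using F[OF M(1)] by blast
      then show ?thesis using eq'[of e] True MM by simp
    next
      case False
      then show ?thesis using f PiE_arb[of f M "\<lambda>_. S" e] PiE_arb[of f' M "\<lambda>_. S" e]
        by (simp add: MM proper_colourings_def)
    qed
    moreover have "g e = g' e" for e
    proof (cases "e \<in> E - M")
      case True
      then show ?thesis using eq'[of e] MM by auto
    next
      case False
      then show ?thesis
        using g PiE_arb[of g "E - M" "\<lambda>_. T" e] PiE_arb[of g' "E - M" "\<lambda>_. T" e]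
        unfolding MM proper_colourings_def by simp
    qed
    ultimately show "x = y" unfolding x y MM by (simp add: fun_eq_iff del: split_paired_All)
  qed
  ultimately have "card ?D \<le> card (proper_colourings E (S \<union> T))"
    using E S by (intro card_inj_on_le finite_proper_colourings) auto
  moreover have "card ?D = (\<Sum>M\<in>F. card (proper_colourings M S \<times> proper_colourings (E - M) T))"
    using finF finM E S by (intro card_SigmaI) (auto intro!: finite_proper_colourings)
  ultimately show ?thesis by (simp add: card_cartesian_product)
qed

lemma proper_colourings_matching:
  assumes "regular_bipartite A B 1 M" "finite A" "finite B"
  shows "1 \<le> card (proper_colourings M {s})"
proof -
  have "inj_on (\<lambda>e\<in>M. s) (star M v)" for v
  proof (cases "v \<in> A <+> B")
    case True
    then have "card (star M v) = 1" using assms(1) by (simp add: regular_bipartite_def)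
    then show ?thesis by (auto simp: card_1_singleton_iff)
  next
    case False
    then have "star M v = {}" using assms(1) by (auto simp: star_def regular_bipartite_def)
    then show ?thesis by simp
  qed
  then have "(\<lambda>e\<in>M. s) \<in> proper_colourings M {s}" by (simp add: proper_colourings_def)
  then show ?thesis
    using finite_proper_colourings[OF regular_bipartite_finite[OF assms], of "{s}"]
    by (metis One_nat_def Suc_leI card_gt_0_iff empty_iff finite.emptyI finite_insert)
qed

section \<open>Recursive lower bound for the number of colourings\<close>

text \<open>The ratio \<open>(2k)! / (k!^2 2^k)\<close> is \<open>(2k choose k) / 2^k\<close>, and
  the bound \<open>4^k / (2k)\<close> for the central binomial coefficient makes it at least
  \<open>2^k / (2k)\<close>. Raising this to the power \<open>2n\<close> gives the
  exponential.\<close>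

lemma card_half_factors_ge:
  assumes E: "regular_bipartite A B (2 * k) E" and fin: "finite A" "finite B"
    and card: "card A = n" "card B = n" and k: "0 < k"
  shows "exp (real n * (2 * real k * ln 2 - 2 * ln (2 * real k)))
    \<le> real (card {S. S \<subseteq> E \<and> regular_bipartite A B k S})"
proof -
  let ?F = "real (card {S. S \<subseteq> E \<and> regular_bipartite A B k S})"
  let ?q = "fact k * fact k * 2 ^ k :: real"
  have q: "0 < ?q" by simp
  have "real (fact (2 * k) ^ (2 * n)) \<le> real (card {S. S \<subseteq> E \<and> regular_bipartite A B k S} *
    (fact k * fact k * 2 ^ k) ^ (2 * n))"
    by (rule of_nat_mono[OF card_half_factors[OF E fin card]])
  then have "fact (2 * k) ^ (2 * n) \<le> ?F * ?q ^ (2 * n)" by simp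
  then have 1: "(fact (2 * k) / ?q) ^ (2 * n) \<le> ?F" using q by (simp add: power_divide divide_le_eq)
  have "fact (2 * k) / ?q = real (2 * k choose k) / 2 ^ k"
    by (simp add: binomial_fact)
  moreover have "2 ^ k / (2 * real k) = 4 ^ k / (2 * real k) / 2 ^ k"
    using power_mult_distrib[of "2::real" 2 k] by (simp add: field_simps)
  ultimately have "2 ^ k / (2 * real k) \<le> fact (2 * k) / ?q"
    using divide_right_mono[OF central_binomial_lower_bound[OF k], of "2 ^ k"] by simp
  moreover have "2 ^ k / (2 * real k) = exp (real k * ln 2 - ln (2 * real k))"
    using k by (simp add: exp_diff exp_of_nat_mult)
  ultimately have "exp (real k * ln 2 - ln (2 * real k)) ^ (2 * n) \<le> (fact (2 * k) / ?q) ^ (2 * n)"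
    by (intro power_mono) auto
  moreover have "exp (real k * ln 2 - ln (2 * real k)) ^ (2 * n) =
      exp (real n * (2 * real k * ln 2 - 2 * ln (2 * real k)))"
    by (simp add: exp_of_nat_mult[symmetric] algebra_simps)
  ultimately show ?thesis using 1 by simp
qed

text \<open>The lower order terms of the exponent are chosen so that it satisfies the recursive bounds
  coming from halving an even degree and from removing a matching in an odd degree.\<close>

definition rate :: "real \<Rightarrow> real" where
  "rate d = d * ln d - 8 * d + 3 * ln d + 6"

text \<open>The right side exceeds the left by \<open>ln x + 6 - 5 * ln 2\<close>, which is
  positive.\<close>

lemma rate_double:
  assumes "1 \<le> x"
  shows "rate (2 * x) \<le> 2 * rate x + 2 * x * ln 2 - 2 * ln (2 * x)"
proof -
  have "ln (2::real) \<le> 1" using ln_le_minus_one[of "2::real"] by simp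
  moreover have "0 \<le> ln x" using assms by simp
  moreover have "ln (2 * x) = ln 2 + ln x" using assms by (simp add: ln_mult)
  ultimately show ?thesis by (simp add: rate_def algebra_simps)
qed

text \<open>After \<open>ln (2x + 1)\<close> is replaced by \<open>ln (2x) + 1 / (2x)\<close>, the
  terms in \<open>ln x\<close> of lower order cancel exactly, which is why \<open>rate\<close> has
  the coefficient 3 at \<open>ln d\<close>; a slack of at least \<open>11 - 6 * ln 2\<close>
  remains.\<close>

lemma rate_double_plus_one:
  assumes "1 \<le> x"
  shows "rate (2 * x + 1) \<le> 2 * rate x + 2 * x * ln 2 - 2 * ln (2 * x)"
proof -
  have l2: "ln (2::real) \<le> 1" using ln_le_minus_one[of "2::real"] by simp
  have lx: "ln (2 * x) = ln 2 + ln x" using assms by (simp add: ln_mult)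
  have "ln ((2 * x + 1) / (2 * x)) \<le> (2 * x + 1) / (2 * x) - 1"
    using assms by (intro ln_le_minus_one) simp
  also have "(2 * x + 1) / (2 * x) - 1 = 1 / (2 * x)" using assms by (simp add: field_simps)
  finally have le: "ln (2 * x + 1) \<le> ln (2 * x) + 1 / (2 * x)" using assms by (simp add: ln_div)
  then have "2 * x * ln (2 * x + 1) \<le> 2 * x * (ln (2 * x) + 1 / (2 * x))"
    using assms by (intro mult_left_mono) auto
  also have "\<dots> = 2 * x * ln (2 * x) + 1" using assms by (simp add: field_simps)
  finally have "2 * x * ln (2 * x + 1) \<le> 2 * x * ln (2 * x) + 1" .
  moreover have "1 / (2 * x) \<le> 1 / 2" using assms by (simp add: field_simps)
  then have "ln (2 * x + 1) \<le> ln 2 + ln x + 1 / 2" using le lx by linarith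
  ultimately show ?thesis using l2 unfolding rate_def lx by (simp add: algebra_simps)
qed

text \<open>Strong induction on the degree. For \<open>d = 2k\<close>, a \<open>k\<close>-factor and
  its complement are coloured from the two halves of the palette; for \<open>d = 2k + 1\<close>, a
  perfect matching first takes one colour.\<close>

lemma card_proper_colourings_ge:
  fixes S :: "'c set"
  assumes "0 < d" "regular_bipartite A B d E" "finite A" "finite B" "card A = n" "card B = n"
    "finite S" "card S = d"
  shows "exp (real n * rate (real d)) \<le> real (card (proper_colourings E S))"
  using assms
proof (induction d arbitrary: E S rule: less_induct)
  case (less d)
  note fin = less.prems(3,4) and card = less.prems(5,6)
  \<comment> \<open>Stated for any \<open>2k\<close>-regular graph and palette with
    \<open>k < d\<close>, so that the odd case can use it for the graph left after removing a
    matching.\<close>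
  have even: "exp (real n * (2 * rate (real k) + 2 * real k * ln 2 - 2 * ln (2 * real k)))
      \<le> real (card (proper_colourings E' S'))"
    if k: "0 < k" "k < d" and E': "regular_bipartite A B (2 * k) E'" and S': "finite S'" "card S' = 2 * k"
    for k E' and S' :: "'c set"
  proof -
    let ?F = "{M. M \<subseteq> E' \<and> regular_bipartite A B k M}"
    obtain T where T: "T \<subseteq> S'" "card T = k" "finite T"
      using obtain_subset_with_card_n[of k S'] S' by (metis le_add1 mult_2)
    have U: "finite (S' - T)" "card (S' - T) = k" "T \<inter> (S' - T) = {}" "T \<union> (S' - T) = S'"
      using T S' by (auto simp: card_Diff_subset)
    let ?c = "exp (real n * rate (real k))"
    have finE': "finite E'" by (rule regular_bipartite_finite[OF E' fin])
    have "real (card ?F) * (?c * ?c) = (\<Sum>M\<in>?F. ?c * ?c)" by simp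
    also have "\<dots> \<le> (\<Sum>M\<in>?F. real (card (proper_colourings M T)) * real (card (proper_colourings (E' - M) (S' - T))))"
    proof (intro sum_mono mult_mono)
      fix M assume M: "M \<in> ?F"
      then show "?c \<le> real (card (proper_colourings M T))"
        using T k by (intro less.IH fin card) auto
      have "regular_bipartite A B (2 * k - k) (E' - M)"
        using M by (intro regular_bipartite_diff[OF E' _ _ fin]) auto
      then show "?c \<le> real (card (proper_colourings (E' - M) (S' - T)))"
        using U k by (intro less.IH fin card) auto
    qed auto
    also have "\<dots> = real (\<Sum>M\<in>?F. card (proper_colourings M T) * card (proper_colourings (E' - M) (S' - T)))"
      by simp
    also have "\<dots> \<le> real (card (proper_colourings E' S'))"
      using proper_colourings_split[OF finE' T(3) U(1,3), of ?F] U(4) by (intro of_nat_mono) auto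
    finally have 1: "real (card ?F) * (?c * ?c) \<le> real (card (proper_colourings E' S'))" .
    have "exp (real n * (2 * real k * ln 2 - 2 * ln (2 * real k))) * (?c * ?c) \<le> real (card ?F) * (?c * ?c)"
      by (intro mult_right_mono card_half_factors_ge[OF E' fin card k(1)]) auto
    also note 1
    finally show ?thesis by (simp add: exp_add[symmetric] algebra_simps)
  qed
  consider "d = 1" | k where "0 < k" "d = 2 * k" | k where "0 < k" "d = 2 * k + 1"
    using less.prems(1) by (metis One_nat_def Suc_eq_plus1 add_0 evenE gr0I mult_0_right oddE)
  then show ?case
  proof cases
    case 1
    then obtain s where "S = {s}" using less.prems(8) card_1_singletonE by metis
    then have "1 \<le> real (card (proper_colourings E S))"
      using proper_colourings_matching[OF less.prems(2)[unfolded 1] fin, of s] by simp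
    \<comment> \<open>Here \<open>rate 1 = -2\<close>, so the exponent is not positive.\<close>
    moreover have "exp (real n * rate (real d)) \<le> 1" by (simp add: 1 rate_def)
    ultimately show ?thesis by linarith
  next
    case (2 k)
    have "exp (real n * rate (real d))
      \<le> exp (real n * (2 * rate (real k) + 2 * real k * ln 2 - 2 * ln (2 * real k)))"
      using rate_double[of "real k"] 2 by (simp add: mult_left_mono)
    also have "\<dots> \<le> real (card (proper_colourings E S))"
      using 2 less.prems by (intro even) auto
    finally show ?thesis .
  next
    case (3 k)
    obtain M where M: "M \<subseteq> E" "regular_bipartite A B 1 M"
      using regular_bipartite_perfect_matching[OF less.prems(2) fin less.prems(1)] by blast
    obtain s where s: "s \<in> S" using less.prems(1,8) by fastforce
    have finE: "finite E" by (rule regular_bipartite_finite[OF less.prems(2) fin])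
    have "exp (real n * rate (real d))
      \<le> exp (real n * (2 * rate (real k) + 2 * real k * ln 2 - 2 * ln (2 * real k)))"
      using rate_double_plus_one[of "real k"] 3 by (simp add: mult_left_mono add.commute)
    also have "\<dots> \<le> real (card (proper_colourings (E - M) (S - {s})))"
    proof (rule even)
      show "0 < k" "k < d" using 3 by auto
      show "regular_bipartite A B (2 * k) (E - M)"
        using regular_bipartite_diff[OF less.prems(2) M(2,1) fin] 3 by simp
      show "finite (S - {s})" "card (S - {s}) = 2 * k" using less.prems(7,8) s 3 by auto
    qed
    also have "\<dots> \<le> real (card (proper_colourings E S))"
    proof (rule of_nat_mono)
      have "card (proper_colourings M {s}) * card (proper_colourings (E - M) (S - {s}))
        \<le> card (proper_colourings E ({s} \<union> (S - {s})))"
        using proper_colourings_split[OF finE, of "{s}" "S - {s}" "{M}"] M(1) less.prems(7) by simp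
      moreover have "{s} \<union> (S - {s}) = S" using s by blast
      moreover have "1 \<le> card (proper_colourings M {s})" by (rule proper_colourings_matching[OF M(2) fin])
      ultimately show "card (proper_colourings (E - M) (S - {s})) \<le> card (proper_colourings E S)"
        by (metis le_trans mult_le_mono1 mult_1)
    qed
    finally show ?thesis .
  qed
qed

section \<open>The number of Latin squares\<close>

lemma complete_regular_bipartite: "regular_bipartite {1..n} {1..n} n ({1..n} \<times> {1..n})"
proof -
  have "star ({1..n} \<times> {1..n}) (Inl a) = {a} \<times> {1..n}" "star ({1..n} \<times> {1..n}) (Inr a) = {1..n} \<times> {a}"
    if "a \<in> {1..n}" for a :: nat
    using that by (auto simp: star_def)
  then show ?thesis by (auto simp: regular_bipartite_def card_cartesian_product)
qed

text \<open>Rows and columns are the stars of the left and right vertices. Injectivity on such a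
  star, which has as many edges as there are symbols, forces every symbol to occur.\<close>

lemma latin_square_of_colouring:
  assumes f: "f \<in> proper_colourings ({1..n} \<times> {1..n}) {1..n}"
  shows "latin_square n ((\<lambda>(r, c). (r, c, f (r, c))) ` ({1..n} \<times> {1..n}))"
proof -
  let ?I = "{1..n}"
  have into: "f (r, c) \<in> ?I" if "r \<in> ?I" "c \<in> ?I" for r c
    using f that unfolding proper_colourings_def by (blast intro: PiE_mem)
  have inj: "inj_on f (star (?I \<times> ?I) v)" for v using f by (simp add: proper_colourings_def)
  have row: "inj_on (\<lambda>c. f (r, c)) ?I" if "r \<in> ?I" for r
  proof (rule inj_onI)
    fix c c' assume "c \<in> ?I" "c' \<in> ?I" "f (r, c) = f (r, c')"
    then show "c = c'" using inj_onD[OF inj[of "Inl r"], of "(r, c)" "(r, c')"] that by (simp add: star_def)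
  qed
  have col: "inj_on (\<lambda>r. f (r, c)) ?I" if "c \<in> ?I" for c
  proof (rule inj_onI)
    fix r r' assume "r \<in> ?I" "r' \<in> ?I" "f (r, c) = f (r', c)"
    then show "r = r'" using inj_onD[OF inj[of "Inr c"], of "(r, c)" "(r', c)"] that by (simp add: star_def)
  qed
  have row_surj: "(\<lambda>c. f (r, c)) ` ?I = ?I" if "r \<in> ?I" for r
    using row[OF that] into[OF that] by (intro endo_inj_surj) auto
  have col_surj: "(\<lambda>r. f (r, c)) ` ?I = ?I" if "c \<in> ?I" for c
    using col[OF that] into[OF _ that] by (intro endo_inj_surj) auto
  have mem: "(r, c, s) \<in> (\<lambda>(r, c). (r, c, f (r, c))) ` (?I \<times> ?I) \<longleftrightarrow> r \<in> ?I \<and> c \<in> ?I \<and> s = f (r, c)" for r c s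
    by auto
  have "\<exists>!c. c \<in> ?I \<and> s = f (r, c)" if r: "r \<in> ?I" and s: "s \<in> ?I" for r s
  proof -
    obtain c where "c \<in> ?I" "s = f (r, c)" using row_surj[OF r] s by blast
    then show ?thesis using row[OF r] by (metis inj_onD)
  qed
  moreover have "\<exists>!r. r \<in> ?I \<and> s = f (r, c)" if c: "c \<in> ?I" and s: "s \<in> ?I" for c s
  proof -
    obtain r where "r \<in> ?I" "s = f (r, c)" using col_surj[OF c] s by blast
    then show ?thesis using col[OF c] by (metis inj_onD)
  qed
  moreover have "(\<lambda>(r, c). (r, c, f (r, c))) ` (?I \<times> ?I) \<subseteq> triples n"
    using into by (auto simp: triples_def)
  ultimately show ?thesis unfolding latin_square_def mem by simp
qed

lemma card_latin_squares_ge: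
  assumes "0 < n"
  shows "exp (real n ^ 2 * ln (real n) - 8 * real n ^ 2) \<le> real (card {L. latin_square n L})"
proof -
  let ?I = "{1..n}"
  let ?g = "\<lambda>f. (\<lambda>(r, c). (r, c, f (r, c))) ` (?I \<times> ?I)"
  let ?P = "proper_colourings (?I \<times> ?I) ?I"
  have "inj_on ?g ?P"
  proof (rule inj_onI)
    fix f f' assume f: "f \<in> ?P" "f' \<in> ?P" and eq: "?g f = ?g f'"
    have "f e = f' e" if "e \<in> ?I \<times> ?I" for e
    proof -
      have "(fst e, snd e, f e) \<in> ?g f'" unfolding eq[symmetric] using that by force
      then show ?thesis by auto
    qed
    then show "f = f'" using f unfolding proper_colourings_def
      by (intro PiE_ext[of f "?I \<times> ?I" "\<lambda>_. ?I"]) auto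
  qed
  moreover have "?g ` ?P \<subseteq> {L. latin_square n L}" using latin_square_of_colouring by blast
  moreover have "finite {L. latin_square n L}"
    by (rule finite_subset[of _ "Pow (triples n)"]) (auto dest: latin_square_subset)
  ultimately have "card ?P \<le> card {L. latin_square n L}" by (rule card_inj_on_le)
  moreover have "exp (real n * rate (real n)) \<le> real (card ?P)"
    using assms by (intro card_proper_colourings_ge[OF _ complete_regular_bipartite]) auto
  \<comment> \<open>The terms dropped from \<open>n * rate n\<close> are \<open>3 * n * ln n\<close>
    and \<open>6 * n\<close>, both non-negative.\<close>
  moreover have "real n ^ 2 * ln (real n) - 8 * real n ^ 2 \<le> real n * rate (real n)"
    using assms by (simp add: rate_def algebra_simps power2_eq_square)
  ultimately show ?thesis by (meson exp_le_cancel_iff of_nat_mono order_trans)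
qed

section \<open>Quotient of the two bounds\<close>

theorem theorem4:
  shows "\<exists>g :: nat \<Rightarrow> real. g \<in> o(\<lambda>n. real n ^ 2) \<and>
    (\<forall>\<^sub>F n in sequentially.
       real (card {L. latin_square n L \<and> \<not> trivial_group (autoparatopy_group n L)}) /
       real (card {L. latin_square n L})
         \<le> real n powr (- (3 * real n ^ 2 / 8) + g n))"
proof (intro exI conjI)
  \<comment> \<open>This is the logarithm to base \<open>n\<close> of the lower-order factors:
    \<open>27 * n ^ (3 * n)\<close> from the paratopisms, \<open>exp (n^2)\<close> from the choice
    of representatives and \<open>exp (8 * n^2)\<close> from the lower bound. The main term is
    \<open>5/8 - 1 = -3/8\<close>.\<close>
  let ?g = "\<lambda>n. 3 * real n + (ln 27 + 9 * real n ^ 2) / ln (real n)"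
  show "?g \<in> o(\<lambda>n. real n ^ 2)" by real_asymp
  show "\<forall>\<^sub>F n in sequentially.
       real (card {L. latin_square n L \<and> \<not> trivial_group (autoparatopy_group n L)}) /
       real (card {L. latin_square n L}) \<le> real n powr (- (3 * real n ^ 2 / 8) + ?g n)"
    using eventually_ge_at_top[of 4]
  proof eventually_elim
    case (elim n)
    let ?l = "ln (real n)"
    have n: "real n > 0" "?l > 0" using elim by auto
    have "27 * real n ^ (3 * n) * (real n powr (5 * real n ^ 2 / 8) * exp (real n ^ 2)) =
      exp (ln 27 + 3 * real n * ?l + 5 * real n ^ 2 / 8 * ?l + real n ^ 2)"
      using n by (simp add: powr_def exp_add powr_realpow[symmetric] mult.assoc)
    with card_symmetric_latin_squares[OF elim]
    have "real (card {L. latin_square n L \<and> \<not> trivial_group (autoparatopy_group n L)})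
      \<le> exp (ln 27 + 3 * real n * ?l + 5 * real n ^ 2 / 8 * ?l + real n ^ 2)" by simp
    then have "real (card {L. latin_square n L \<and> \<not> trivial_group (autoparatopy_group n L)}) /
       real (card {L. latin_square n L}) \<le>
      exp (ln 27 + 3 * real n * ?l + 5 * real n ^ 2 / 8 * ?l + real n ^ 2) /
      exp (real n ^ 2 * ?l - 8 * real n ^ 2)"
      using card_latin_squares_ge[of n] elim by (intro frac_le) auto
    also have "\<dots> = exp ((- (3 * real n ^ 2 / 8) + ?g n) * ?l)"
      using n by (simp add: exp_diff[symmetric] field_simps)
    also have "\<dots> = real n powr (- (3 * real n ^ 2 / 8) + ?g n)" using n by (simp add: powr_def)
    finally show ?case .
  qed
qed

end
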